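(* Let $P$ be a non-discrete poset (i.e. there exist $p<q$ in $P$). There exists no model structure on $\mathrm{Top}_P$ satisfying all of the following properties: (1) For every monomorphism $A\to B$ in $\mathrm{sSet}_P$, its realization $|A|_P\to|B|_P$ is a cofibration. (2) Stratified homotopy equivalences are weak equivalences. (3) For every weak equivalence $X\to Y$, the induced maps between classical homotopy links $\mathrm{HoLink}_{p<q}(X)\to\mathrm{HoLink}_{p<q}(Y)$, $p<q$ in $P$, are weak homotopy equivalences of spaces.
   Context: Spaces are $\Delta$-generated. A poset $P$ carries the topology whose closed sets are the down-closed subsets; $N(P)$ is its nerve. $\mathrm{Top}_P$ is the category of spaces $X$ with a continuous map $\varphi_X\colon X\to P$ and continuous maps over $P$ (stratum preserving maps); the strata are $X^p=\varphi_X^{-1}(p)$. $\mathrm{sSet}_P$ is the category of simplicial sets $K$ with a simplicial map $\varphi_K\colon K\to N(P)$ and simplicial maps over $N(P)$. The realization $|K|_P\in\mathrm{Top}_P$ is $|K|$ with $\varphi_P\circ|\varphi_K|$, where $\varphi_P\colon|N(P)|\to P$ sends the point with barycentric coordinates $(t_0,\dots,t_n)$ in the simplex of $[p_0<\dots<p_n]$ to $p_m$, $m=\max\{i\mid t_i\ne0\}$. A stratified homotopy between $f,g\colon X\to Y$ in $\mathrm{Top}_P$ is a map $X\times[0,1]\to Y$ over $P$ (with $X\times[0,1]$ stratified via the projection to $X$) restricting to $f$ and $g$ at the ends; a stratified homotopy equivalence is a map in $\mathrm{Top}_P$ with an inverse up to stratified homotopy. The classical homotopy link for $p<q$ is $$\mathrm{HoLink}_{p<q}(X)=\{\gamma\colon[0,1]\to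 X\text{ continuous}\mid\gamma(0)\in X^p,\ \gamma(t)\in X^q\ \forall t>0\}$$ with the topology induced from the space of continuous maps $[0,1]\to X$. *)

theory Defs
  imports "HOL-Homology.Homology" "HOL-Library.Equipollence"
begin

section \<open>Categories and model structures\<close>

record ('o, 'm) precategory =
  Obj :: "'o set"
  Arr :: "'m set"
  Dom :: "'m \<Rightarrow> 'o"
  Cod :: "'m \<Rightarrow> 'o"
  Ident :: "'o \<Rightarrow> 'm"
  Comp :: "'m \<Rightarrow> 'm \<Rightarrow> 'm"

text \<open>\<^term>\<open>Comp C g f\<close> is ``\<open>g\<close> after \<open>f\<close>''; its value is only meaningful if
  \<^prop>\<open>Cod C f = Dom C g\<close>.\<close>

definition cat_hom :: "('o, 'm) precategory \<Rightarrow> 'o \<Rightarrow> 'o \<Rightarrow> 'm set" where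
  "cat_hom C X Y = {f \<in> Arr C. Dom C f = X \<and> Cod C f = Y}"

locale category =
  fixes C :: "('o, 'm) precategory"
  assumes dom_cod: "f \<in> Arr C \<Longrightarrow> Dom C f \<in> Obj C \<and> Cod C f \<in> Obj C"
    and ident: "X \<in> Obj C \<Longrightarrow> Ident C X \<in> cat_hom C X X"
    and comp: "\<lbrakk>f \<in> cat_hom C X Y; g \<in> cat_hom C Y Z\<rbrakk> \<Longrightarrow> Comp C g f \<in> cat_hom C X Z"
    and ident_left: "f \<in> cat_hom C X Y \<Longrightarrow> Comp C (Ident C Y) f = f"
    and ident_right: "f \<in> cat_hom C X Y \<Longrightarrow> Comp C f (Ident C X) = f"
    and assoc: "\<lbrakk>f \<in> cat_hom C V X; g \<in> cat_hom C X Y; h \<in> cat_hom C Y Z\<rbrakk>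
      \<Longrightarrow> Comp C h (Comp C g f) = Comp C (Comp C h g) f"

definition monomorphism :: "('o, 'm) precategory \<Rightarrow> 'm \<Rightarrow> bool" where
  "monomorphism C f \<longleftrightarrow> f \<in> Arr C \<and>
     (\<forall>Z. \<forall>g \<in> cat_hom C Z (Dom C f). \<forall>h \<in> cat_hom C Z (Dom C f).
        Comp C f g = Comp C f h \<longrightarrow> g = h)"

definition arrow_retract :: "('o, 'm) precategory \<Rightarrow> 'm \<Rightarrow> 'm \<Rightarrow> bool" where
  "arrow_retract C f g \<longleftrightarrow> f \<in> Arr C \<and> g \<in> Arr C \<and>
     (\<exists>i \<in> cat_hom C (Dom C f) (Dom C g). \<exists>r \<in> cat_hom C (Dom C g) (Dom C f).
      \<exists>j \<in> cat_hom C (Cod C f) (Cod C g). \<exists>s \<in> cat_hom C (Cod C g) (Cod C f).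
        Comp C r i = Ident C (Dom C f) \<and> Comp C s j = Ident C (Cod C f) \<and>
        Comp C g i = Comp C j f \<and> Comp C f r = Comp C s g)"

definition has_lifting :: "('o, 'm) precategory \<Rightarrow> 'm \<Rightarrow> 'm \<Rightarrow> bool" where
  "has_lifting C i p \<longleftrightarrow>
     (\<forall>u \<in> cat_hom C (Dom C i) (Dom C p). \<forall>v \<in> cat_hom C (Cod C i) (Cod C p).
        Comp C p u = Comp C v i \<longrightarrow>
        (\<exists>l \<in> cat_hom C (Cod C i) (Dom C p). Comp C l i = u \<and> Comp C p l = v))"

text \<open>Factorizations are not required to be functorial.\<close>

locale model_structure = category C
  for C :: "('o, 'm) precategory" +
  fixes Weq Cof Fib :: "'m set"
  assumes classes: "Weq \<subseteq> Arr C" "Cof \<subseteq> Arr C" "Fib \<subseteq> Arr C"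
    and two_of_three:
      "\<lbrakk>f \<in> cat_hom C X Y; g \<in> cat_hom C Y Z; f \<in> Weq; g \<in> Weq\<rbrakk> \<Longrightarrow> Comp C g f \<in> Weq"
      "\<lbrakk>f \<in> cat_hom C X Y; g \<in> cat_hom C Y Z; f \<in> Weq; Comp C g f \<in> Weq\<rbrakk> \<Longrightarrow> g \<in> Weq"
      "\<lbrakk>f \<in> cat_hom C X Y; g \<in> cat_hom C Y Z; g \<in> Weq; Comp C g f \<in> Weq\<rbrakk> \<Longrightarrow> f \<in> Weq"
    and retracts:
      "\<lbrakk>arrow_retract C f g; g \<in> Weq\<rbrakk> \<Longrightarrow> f \<in> Weq"
      "\<lbrakk>arrow_retract C f g; g \<in> Cof\<rbrakk> \<Longrightarrow> f \<in> Cof"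
      "\<lbrakk>arrow_retract C f g; g \<in> Fib\<rbrakk> \<Longrightarrow> f \<in> Fib"
    and lifting:
      "\<lbrakk>i \<in> Cof \<inter> Weq; p \<in> Fib\<rbrakk> \<Longrightarrow> has_lifting C i p"
      "\<lbrakk>i \<in> Cof; p \<in> Fib \<inter> Weq\<rbrakk> \<Longrightarrow> has_lifting C i p"
    and factorization:
      "f \<in> cat_hom C X Y \<Longrightarrow>
         \<exists>Z. \<exists>i \<in> cat_hom C X Z. \<exists>p \<in> cat_hom C Z Y.
           i \<in> Cof \<inter> Weq \<and> p \<in> Fib \<and> Comp C p i = f"
      "f \<in> cat_hom C X Y \<Longrightarrow>
         \<exists>Z. \<exists>i \<in> cat_hom C X Z. \<exists>p \<in> cat_hom C Z Y.
           i \<in> Cof \<and> p \<in> Fib \<inter> Weq \<and> Comp C p i = f"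

datatype ('o, 'f) arrow = Arrow (src: 'o) (tgt: 'o) (fn: 'f)


section \<open>Delta-generated spaces and the poset topology\<close>

abbreviation simplex_topology :: "nat \<Rightarrow> (nat \<Rightarrow> real) topology" where
  "simplex_topology n \<equiv> subtopology (powertop_real UNIV) (standard_simplex n)"

definition delta_ification :: "'a topology \<Rightarrow> 'a topology" where
  "delta_ification X = topology (\<lambda>U. U \<subseteq> topspace X \<and>
     (\<forall>n \<sigma>. singular_simplex n X \<sigma> \<longrightarrow>
        openin (simplex_topology n) {t \<in> standard_simplex n. \<sigma> t \<in> U}))"

lemma openin_delta_ification:
  "openin (delta_ification X) U \<longleftrightarrow> U \<subseteq> topspace X \<and>
     (\<forall>n \<sigma>. singular_simplex n X \<sigma> \<longrightarrow>
        openin (simplex_topology n) {t \<in> standard_simplex n. \<sigma> t \<in> U})"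
proof -
  let ?P = "\<lambda>U. U \<subseteq> topspace X \<and> (\<forall>n \<sigma>. singular_simplex n X \<sigma> \<longrightarrow>
        openin (simplex_topology n) {t \<in> standard_simplex n. \<sigma> t \<in> U})"
  have "istopology ?P"
    unfolding istopology_def
  proof (intro conjI allI impI)
    fix S T assume ST: "?P S" "?P T"
    then show "S \<inter> T \<subseteq> topspace X" by blast
    fix n \<sigma> assume "singular_simplex n X \<sigma>"
    moreover have "{t \<in> standard_simplex n. \<sigma> t \<in> S \<inter> T} =
      {t \<in> standard_simplex n. \<sigma> t \<in> S} \<inter> {t \<in> standard_simplex n. \<sigma> t \<in> T}" by blast
    ultimately show "openin (simplex_topology n) {t \<in> standard_simplex n. \<sigma> t \<in> S \<inter> T}"
      using ST by (simp only: openin_Int)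
  next
    fix \<K> assume K: "\<forall>K\<in>\<K>. ?P K"
    then show "\<Union>\<K> \<subseteq> topspace X" by blast
    fix n \<sigma> assume s: "singular_simplex n X \<sigma>"
    have eq: "{t \<in> standard_simplex n. \<sigma> t \<in> \<Union>\<K>} =
      \<Union> ((\<lambda>K. {t \<in> standard_simplex n. \<sigma> t \<in> K}) ` \<K>)" by blast
    show "openin (simplex_topology n) {t \<in> standard_simplex n. \<sigma> t \<in> \<Union>\<K>}"
      unfolding eq by (rule openin_Union) (use K s in blast)
  qed
  then show ?thesis
    by (simp add: delta_ification_def topology_inverse')
qed

definition delta_generated :: "'a topology \<Rightarrow> bool" where
  "delta_generated X \<longleftrightarrow> delta_ification X = X"

definition poset_topology :: "'p::order topology" where
  "poset_topology = topology (\<lambda>U. \<forall>x \<in> U. \<forall>y. x \<le> y \<longrightarrow> y \<in> U)"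

lemma openin_poset_topology:
  "openin poset_topology U \<longleftrightarrow> (\<forall>x \<in> U. \<forall>y. x \<le> y \<longrightarrow> y \<in> U)"
proof -
  have "istopology (\<lambda>U::'a set. \<forall>x \<in> U. \<forall>y. x \<le> y \<longrightarrow> y \<in> U)"
    unfolding istopology_def by blast
  then show ?thesis by (simp add: poset_topology_def topology_inverse')
qed

lemma topspace_poset_topology [simp]: "topspace poset_topology = UNIV"
proof -
  have "openin poset_topology (UNIV :: 'a set)" by (simp add: openin_poset_topology)
  then show ?thesis using openin_subset by blast
qed

lemma closedin_poset_topology:
  "closedin poset_topology S \<longleftrightarrow> (\<forall>x \<in> S. \<forall>y. y \<le> x \<longrightarrow> y \<in> S)"
  by (auto simp: closedin_def openin_poset_topology)


section \<open>Stratified spaces\<close>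

type_synonym ('a, 'p) strat_space = "'a topology \<times> ('a \<Rightarrow> 'p)"

definition stratified_space :: "('a, 'p::order) strat_space \<Rightarrow> bool" where
  "stratified_space X \<longleftrightarrow> delta_generated (fst X) \<and>
     continuous_map (fst X) poset_topology (snd X) \<and> snd X \<in> extensional (topspace (fst X))"

definition stratum :: "('a, 'p) strat_space \<Rightarrow> 'p \<Rightarrow> 'a set" where
  "stratum X p = {x \<in> topspace (fst X). snd X x = p}"

definition strat_map :: "('a, 'p) strat_space \<Rightarrow> ('b, 'p) strat_space \<Rightarrow> ('a \<Rightarrow> 'b) \<Rightarrow> bool" where
  "strat_map X Y f \<longleftrightarrow> continuous_map (fst X) (fst Y) f \<and>
     (\<forall>x \<in> topspace (fst X). snd Y (f x) = snd X x)"

definition strat_homeomorphism ::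
    "('a, 'p) strat_space \<Rightarrow> ('b, 'p) strat_space \<Rightarrow> ('a \<Rightarrow> 'b) \<Rightarrow> bool" where
  "strat_homeomorphism X Y f \<longleftrightarrow> homeomorphic_map (fst X) (fst Y) f \<and> strat_map X Y f"

text \<open>The type \<open>'u\<close> plays the role of a universe: a set is small if its cardinality is less than
  that of \<open>'u\<close>, and up to isomorphism the small spaces are those carried by small subsets
  of \<open>'u\<close>. For \<open>'u\<close> of inaccessible cardinality this is a Grothendieck universe.\<close>

definition Top_P ::
    "(('u, 'p::order) strat_space, (('u, 'p) strat_space, 'u \<Rightarrow> 'u) arrow) precategory" where
  "Top_P =
    \<lparr>Obj = {X. stratified_space X \<and> topspace (fst X) \<prec> (UNIV :: 'u set)},
     Arr = {f.
       stratified_space (src f) \<and> topspace (fst (src f)) \<prec> (UNIV :: 'u set) \<and>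
       stratified_space (tgt f) \<and> topspace (fst (tgt f)) \<prec> (UNIV :: 'u set) \<and>
       strat_map (src f) (tgt f) (fn f) \<and> fn f \<in> extensional (topspace (fst (src f)))},
     Dom = src, Cod = tgt,
     Ident = (\<lambda>X. Arrow X X (restrict id (topspace (fst X)))),
     Comp = (\<lambda>g f. Arrow (src f) (tgt g) (compose (topspace (fst (src f))) (fn g) (fn f)))\<rparr>"

text \<open>\<^const>\<open>homotopic_with\<close> asks for a homotopy on \<open>[0,1] \<times> X\<close> (product topology, which is
  already Delta-generated for Delta-generated \<open>X\<close>) all of whose stages are stratum preserving.\<close>

definition strat_homotopic ::
    "('a, 'p) strat_space \<Rightarrow> ('b, 'p) strat_space \<Rightarrow> ('a \<Rightarrow> 'b) \<Rightarrow> ('a \<Rightarrow> 'b) \<Rightarrow> bool" where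
  "strat_homotopic X Y f g \<longleftrightarrow>
     homotopic_with (\<lambda>h. \<forall>x \<in> topspace (fst X). snd Y (h x) = snd X x) (fst X) (fst Y) f g"

definition strat_homotopy_equivalence ::
    "('a, 'p) strat_space \<Rightarrow> ('b, 'p) strat_space \<Rightarrow> ('a \<Rightarrow> 'b) \<Rightarrow> bool" where
  "strat_homotopy_equivalence X Y f \<longleftrightarrow> strat_map X Y f \<and>
     (\<exists>g. strat_map Y X g \<and> strat_homotopic X X (g \<circ> f) id \<and> strat_homotopic Y Y (f \<circ> g) id)"


section \<open>Stratified simplicial sets\<close>

text \<open>\<^term>\<open>act K m n \<alpha>\<close> is the operator from the \<open>n\<close>-simplices to the \<open>m\<close>-simplices of \<open>K\<close>
  induced by \<open>\<alpha> : [m] \<rightarrow> [n]\<close>.\<close>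

record 'v sset =
  simps :: "nat \<Rightarrow> 'v set"
  act :: "nat \<Rightarrow> nat \<Rightarrow> (nat \<Rightarrow> nat) \<Rightarrow> 'v \<Rightarrow> 'v"

definition Delta_maps :: "nat \<Rightarrow> nat \<Rightarrow> (nat \<Rightarrow> nat) set" where
  "Delta_maps m n = {\<alpha> \<in> {..m} \<rightarrow>\<^sub>E {..n}. mono_on {..m} \<alpha>}"

definition simplicial_set :: "'v sset \<Rightarrow> bool" where
  "simplicial_set K \<longleftrightarrow>
     (\<forall>m n. \<forall>\<alpha> \<in> Delta_maps m n. act K m n \<alpha> \<in> simps K n \<rightarrow> simps K m) \<and>
     (\<forall>n. \<forall>x \<in> simps K n. act K n n (restrict id {..n}) x = x) \<and>
     (\<forall>l m n. \<forall>\<beta> \<in> Delta_maps l m. \<forall>\<alpha> \<in> Delta_maps m n. \<forall>x \<in> simps K n.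
        act K l m \<beta> (act K m n \<alpha> x) = act K l n (compose {..l} \<alpha> \<beta>) x)"

definition simplicial_map :: "'v sset \<Rightarrow> 'w sset \<Rightarrow> (nat \<Rightarrow> 'v \<Rightarrow> 'w) \<Rightarrow> bool" where
  "simplicial_map K L f \<longleftrightarrow>
     (\<forall>n. f n \<in> simps K n \<rightarrow> simps L n) \<and>
     (\<forall>m n. \<forall>\<alpha> \<in> Delta_maps m n. \<forall>x \<in> simps K n. f m (act K m n \<alpha> x) = act L m n \<alpha> (f n x))"

definition nerve :: "(nat \<Rightarrow> 'p::order) sset" where
  "nerve = \<lparr>simps = (\<lambda>n. {\<sigma> \<in> extensional {..n}. mono_on {..n} \<sigma>}),
            act = (\<lambda>m n \<alpha> \<sigma>. compose {..m} \<sigma> \<alpha>)\<rparr>"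

type_synonym ('v, 'p) strat_sset = "'v sset \<times> (nat \<Rightarrow> 'v \<Rightarrow> nat \<Rightarrow> 'p)"

definition stratified_sset :: "('v, 'p::order) strat_sset \<Rightarrow> bool" where
  "stratified_sset K \<longleftrightarrow> simplicial_set (fst K) \<and> simplicial_map (fst K) nerve (snd K)"

definition small_sset :: "'u sset \<Rightarrow> bool" where
  "small_sset K \<longleftrightarrow> (\<Union>n. simps K n) \<prec> (UNIV :: 'u set)"

definition sSet_P ::
    "(('u, 'p::order) strat_sset, (('u, 'p) strat_sset, nat \<Rightarrow> 'u \<Rightarrow> 'u) arrow) precategory" where
  "sSet_P =
    \<lparr>Obj = {K. stratified_sset K \<and> small_sset (fst K)},
     Arr = {f.
       stratified_sset (src f) \<and> small_sset (fst (src f)) \<and>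
       stratified_sset (tgt f) \<and> small_sset (fst (tgt f)) \<and>
       simplicial_map (fst (src f)) (fst (tgt f)) (fn f) \<and>
       (\<forall>n. fn f n \<in> extensional (simps (fst (src f)) n)) \<and>
       (\<forall>n. \<forall>x \<in> simps (fst (src f)) n. snd (tgt f) n (fn f n x) = snd (src f) n x)},
     Dom = src, Cod = tgt,
     Ident = (\<lambda>K. Arrow K K (\<lambda>n. restrict id (simps (fst K) n))),
     Comp = (\<lambda>g f. Arrow (src f) (tgt g) (\<lambda>n. compose (simps (fst (src f)) n) (fn g n) (fn f n)))\<rparr>"


section \<open>Realization\<close>

text \<open>\<^term>\<open>(n, x, t)\<close> stands for the point with barycentric coordinates \<open>t\<close> in the closed
  \<open>n\<close>-simplex labelled by \<open>x\<close>; the realization is the quotient of the coproduct of all these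
  simplices by the equivalence relation generated by \<open>(\<alpha>\<^sup>* x, t) \<sim> (x, \<alpha>\<^sub>* t)\<close>.\<close>

type_synonym 'v cell_point = "nat \<times> 'v \<times> (nat \<Rightarrow> real)"

definition simplex_push :: "nat \<Rightarrow> (nat \<Rightarrow> nat) \<Rightarrow> (nat \<Rightarrow> real) \<Rightarrow> nat \<Rightarrow> real" where
  "simplex_push m \<alpha> t = (\<lambda>j. \<Sum>i | i \<le> m \<and> \<alpha> i = j. t i)"

definition cell_points :: "'v sset \<Rightarrow> 'v cell_point set" where
  "cell_points K = {(n, x, t). x \<in> simps K n \<and> t \<in> standard_simplex n}"

definition gluing :: "'v sset \<Rightarrow> ('v cell_point \<times> 'v cell_point) set" where
  "gluing K = {((m, act K m n \<alpha> x, t), (n, x, simplex_push m \<alpha> t)) | m n \<alpha> x t.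
     \<alpha> \<in> Delta_maps m n \<and> x \<in> simps K n \<and> t \<in> standard_simplex m}"

definition gluing_equiv :: "'v sset \<Rightarrow> ('v cell_point \<times> 'v cell_point) set" where
  "gluing_equiv K = (gluing K \<union> (gluing K)\<inverse>)\<^sup>* \<inter> cell_points K \<times> cell_points K"

definition realization :: "'v sset \<Rightarrow> 'v cell_point set topology" where
  "realization K = topology (\<lambda>U. U \<subseteq> cell_points K // gluing_equiv K \<and>
     (\<forall>n. \<forall>x \<in> simps K n.
        openin (simplex_topology n) {t \<in> standard_simplex n. gluing_equiv K `` {(n, x, t)} \<in> U}))"

lemma openin_realization:
  "openin (realization K) U \<longleftrightarrow> U \<subseteq> cell_points K // gluing_equiv K \<and>
     (\<forall>n. \<forall>x \<in> simps K n.
        openin (simplex_topology n) {t \<in> standard_simplex n. gluing_equiv K `` {(n, x, t)} \<in> U})"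
proof -
  let ?q = "\<lambda>n x t. gluing_equiv K `` {(n, x, t)}"
  let ?P = "\<lambda>U. U \<subseteq> cell_points K // gluing_equiv K \<and> (\<forall>n. \<forall>x \<in> simps K n.
        openin (simplex_topology n) {t \<in> standard_simplex n. ?q n x t \<in> U})"
  have "istopology ?P"
    unfolding istopology_def
  proof (intro conjI allI impI ballI)
    fix S T assume ST: "?P S" "?P T"
    then show "S \<inter> T \<subseteq> cell_points K // gluing_equiv K" by blast
    fix n x assume "x \<in> simps K n"
    moreover have "{t \<in> standard_simplex n. ?q n x t \<in> S \<inter> T} =
      {t \<in> standard_simplex n. ?q n x t \<in> S} \<inter> {t \<in> standard_simplex n. ?q n x t \<in> T}" by blast
    ultimately show "openin (simplex_topology n) {t \<in> standard_simplex n. ?q n x t \<in> S \<inter> T}"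
      using ST by (simp only: openin_Int)
  next
    fix \<K> assume K: "\<forall>U\<in>\<K>. ?P U"
    then show "\<Union>\<K> \<subseteq> cell_points K // gluing_equiv K" by blast
    fix n x assume x: "x \<in> simps K n"
    have eq: "{t \<in> standard_simplex n. ?q n x t \<in> \<Union>\<K>} =
      \<Union> ((\<lambda>U. {t \<in> standard_simplex n. ?q n x t \<in> U}) ` \<K>)" by blast
    show "openin (simplex_topology n) {t \<in> standard_simplex n. ?q n x t \<in> \<Union>\<K>}"
      unfolding eq by (rule openin_Union) (use K x in blast)
  qed
  then show ?thesis
    by (simp add: realization_def topology_inverse')
qed

lemma equiv_gluing_equiv: "equiv (cell_points K) (gluing_equiv K)"
proof (rule equivI)
  show "refl_on (cell_points K) (gluing_equiv K)"
    by (auto simp: refl_on_def gluing_equiv_def)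
  have "sym ((gluing K \<union> (gluing K)\<inverse>)\<^sup>*)"
    by (intro sym_rtrancl) (auto simp: sym_def)
  then show "sym (gluing_equiv K)"
    by (auto simp: gluing_equiv_def sym_def)
  show "trans (gluing_equiv K)"
    unfolding gluing_equiv_def trans_def by (blast intro: rtrancl_trans)
qed (auto simp: gluing_equiv_def)

lemma topspace_realization: "topspace (realization K) = cell_points K // gluing_equiv K"
proof
  show "topspace (realization K) \<subseteq> cell_points K // gluing_equiv K"
    using openin_realization openin_topspace by metis
  have "{t \<in> standard_simplex n. gluing_equiv K `` {(n, x, t)} \<in> cell_points K // gluing_equiv K}
      = standard_simplex n" if "x \<in> simps K n" for n x
    using that by (auto simp: cell_points_def intro: quotientI)
  then have "openin (realization K) (cell_points K // gluing_equiv K)"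
    by (auto simp: openin_realization openin_subtopology_self
        intro: openin_topspace[of "simplex_topology _", simplified])
  then show "cell_points K // gluing_equiv K \<subseteq> topspace (realization K)"
    by (rule openin_subset)
qed

definition realization_map ::
    "'w sset \<Rightarrow> (nat \<Rightarrow> 'v \<Rightarrow> 'w) \<Rightarrow> 'v cell_point set \<Rightarrow> 'w cell_point set" where
  "realization_map L f \<xi> = gluing_equiv L `` ((\<lambda>(n, x, t). (n, f n x, t)) ` \<xi>)"

text \<open>The value of the following map may be computed from any representative,
  see the lemma \<open>nerve_strat_class\<close>; for nondegenerate \<open>\<sigma>\<close> it is the usual definition.\<close>

definition nerve_strat :: "(nat \<Rightarrow> 'p::order) cell_point set \<Rightarrow> 'p" where
  "nerve_strat \<xi> = (THE p. \<exists>(n, \<sigma>, t) \<in> \<xi>. p = \<sigma> (Max {i. i \<le> n \<and> t i \<noteq> 0}))"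

lemma Max_support_push:
  assumes \<alpha>: "\<alpha> \<in> Delta_maps m n" and t: "t \<in> standard_simplex m"
  shows "Max {j. j \<le> n \<and> simplex_push m \<alpha> t j \<noteq> 0} = \<alpha> (Max {i. i \<le> m \<and> t i \<noteq> 0})"
    and "Max {i. i \<le> m \<and> t i \<noteq> 0} \<le> m"
proof -
  let ?S = "{i. i \<le> m \<and> t i \<noteq> 0}"
  have tpos: "t i \<ge> 0" for i using t by (auto simp: standard_simplex_def)
  have ne: "?S \<noteq> {}"
  proof
    assume "?S = {}"
    then have "(\<Sum>i\<le>m. t i) = 0" by (intro sum.neutral) auto
    then show False using t by (simp add: standard_simplex_def)
  qed
  have fin: "finite ?S" by simp
  have MS: "Max ?S \<in> ?S" using Max_in[OF fin ne] .
  then show "Max ?S \<le> m" by simp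
  have "simplex_push m \<alpha> t j \<noteq> 0 \<longleftrightarrow> (\<exists>i. i \<le> m \<and> \<alpha> i = j \<and> t i \<noteq> 0)" for j
    unfolding simplex_push_def using tpos by (subst sum_nonneg_eq_0_iff) auto
  then have eq: "{j. j \<le> n \<and> simplex_push m \<alpha> t j \<noteq> 0} = \<alpha> ` ?S"
    using \<alpha> by (auto simp: Delta_maps_def PiE_iff)
  show "Max {j. j \<le> n \<and> simplex_push m \<alpha> t j \<noteq> 0} = \<alpha> (Max ?S)"
    unfolding eq
  proof (rule Max_eqI)
    fix y assume "y \<in> \<alpha> ` ?S"
    then obtain i where i: "i \<in> ?S" "y = \<alpha> i" by blast
    then have "i \<le> Max ?S" using fin by simp
    with i MS \<alpha> show "y \<le> \<alpha> (Max ?S)"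
      by (auto simp: Delta_maps_def mono_on_def)
  qed (use MS in auto)
qed

lemma nerve_strat_class:
  assumes "(n, \<sigma>, t) \<in> cell_points nerve"
  shows "nerve_strat (gluing_equiv nerve `` {(n, \<sigma>, t)}) = \<sigma> (Max {i. i \<le> n \<and> t i \<noteq> 0})"
proof -
  define v :: "(nat \<Rightarrow> 'a) cell_point \<Rightarrow> 'a"
    where "v = (\<lambda>(n, \<sigma>, t). \<sigma> (Max {i. i \<le> n \<and> t i \<noteq> 0}))"
  have g: "v a = v b" if "(a, b) \<in> gluing nerve" for a b
  proof -
    from that obtain m n \<alpha> \<sigma> t where ab: "a = (m, compose {..m} \<sigma> \<alpha>, t)"
        "b = (n, \<sigma>, simplex_push m \<alpha> t)" and \<alpha>: "\<alpha> \<in> Delta_maps m n" "t \<in> standard_simplex m"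
      by (auto simp: gluing_def nerve_def)
    show ?thesis using Max_support_push[OF \<alpha>] by (simp add: ab v_def compose_def)
  qed
  have "v a = v b" if "(a, b) \<in> (gluing nerve \<union> (gluing nerve)\<inverse>)\<^sup>*" for a b
    using that by (induction rule: rtrancl_induct) (use g in force)+
  then have "v b = v (n, \<sigma>, t)" if "b \<in> gluing_equiv nerve `` {(n, \<sigma>, t)}" for b
    using that unfolding gluing_equiv_def by (metis IntD1 Image_singleton_iff)
  moreover have "(n, \<sigma>, t) \<in> gluing_equiv nerve `` {(n, \<sigma>, t)}"
    using assms equiv_class_self[OF equiv_gluing_equiv] by blast
  ultimately have "(THE p. \<exists>b \<in> gluing_equiv nerve `` {(n, \<sigma>, t)}. p = v b) = v (n, \<sigma>, t)"
    by (intro the_equality) blast+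
  then show ?thesis
    by (simp add: nerve_strat_def v_def case_prod_unfold)
qed

definition realize :: "('v, 'p::order) strat_sset \<Rightarrow> ('v cell_point set, 'p) strat_space" where
  "realize K = (realization (fst K),
     restrict (nerve_strat \<circ> realization_map nerve (snd K)) (topspace (realization (fst K))))"

text \<open>The points of a realization are not elements of \<open>'u\<close>, so an arrow of \<^const>\<open>Top_P\<close> can only
  be the realization of \<open>i\<close> up to isomorphism of arrows. If \<open>'u\<close> has more than continuum many
  elements, every small simplicial set has a small realization, hence such arrows exist.\<close>

definition is_realization_of ::
    "(('u, 'p::order) strat_space, 'u \<Rightarrow> 'u) arrow \<Rightarrow>
     (('u, 'p) strat_sset, nat \<Rightarrow> 'u \<Rightarrow> 'u) arrow \<Rightarrow> bool" where
  "is_realization_of f i \<longleftrightarrow>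
     (\<exists>h k. strat_homeomorphism (realize (src i)) (src f) h \<and>
            strat_homeomorphism (realize (tgt i)) (tgt f) k \<and>
            (\<forall>\<xi> \<in> topspace (fst (realize (src i))).
               k (realization_map (fst (tgt i)) (fn i) \<xi>) = fn f (h \<xi>)))"


section \<open>Homotopy links and weak homotopy equivalences\<close>

definition compact_open :: "'a topology \<Rightarrow> 'b topology \<Rightarrow> ('a \<Rightarrow> 'b) topology" where
  "compact_open X Y = topology_generated_by
     {{f. continuous_map X Y f \<and> f \<in> extensional (topspace X) \<and> f ` K \<subseteq> U} | K U.
        compactin X K \<and> openin Y U}"

definition holink_set :: "'p \<Rightarrow> 'p \<Rightarrow> ('a, 'p) strat_space \<Rightarrow> (real \<Rightarrow> 'a) set" where
  "holink_set p q X = {\<gamma>. continuous_map (top_of_set {0..1}) (fst X) \<gamma> \<and> \<gamma> \<in> extensional {0..1} \<and>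
     \<gamma> 0 \<in> stratum X p \<and> (\<forall>t \<in> {0<..1}. \<gamma> t \<in> stratum X q)}"

text \<open>Mapping spaces and subspaces are formed in Delta-generated spaces; applying
  \<^const>\<open>delta_ification\<close> once at the end gives the same result as applying it at both stages.\<close>

definition holink :: "'p \<Rightarrow> 'p \<Rightarrow> ('a, 'p) strat_space \<Rightarrow> (real \<Rightarrow> 'a) topology" where
  "holink p q X =
     delta_ification (subtopology (compact_open (top_of_set {0..1}) (fst X)) (holink_set p q X))"

definition holink_map :: "('a \<Rightarrow> 'b) \<Rightarrow> (real \<Rightarrow> 'a) \<Rightarrow> (real \<Rightarrow> 'b)" where
  "holink_map f \<gamma> = compose {0..1} f \<gamma>"

definition cube :: "nat \<Rightarrow> (nat \<Rightarrow> real) topology" where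
  "cube n = product_topology (\<lambda>_. top_of_set {0..1}) {..<n}"

definition cube_boundary :: "nat \<Rightarrow> (nat \<Rightarrow> real) set" where
  "cube_boundary n = {t \<in> topspace (cube n). \<exists>i<n. t i = 0 \<or> t i = 1}"

definition spheroids :: "nat \<Rightarrow> 'a topology \<Rightarrow> 'a \<Rightarrow> ((nat \<Rightarrow> real) \<Rightarrow> 'a) set" where
  "spheroids n X x = {h. continuous_map (cube n) X h \<and> h ` cube_boundary n \<subseteq> {x}}"

definition spheroid_homotopy ::
    "nat \<Rightarrow> 'a topology \<Rightarrow> 'a \<Rightarrow> (((nat \<Rightarrow> real) \<Rightarrow> 'a) \<times> ((nat \<Rightarrow> real) \<Rightarrow> 'a)) set" where
  "spheroid_homotopy n X x = {(h, k).
     homotopic_with (\<lambda>l. l ` cube_boundary n \<subseteq> {x}) (cube n) X h k}"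

text \<open>Underlying set of the \<open>n\<close>-th homotopy group. The group structure is not needed: maps induced
  by continuous maps are homomorphisms, so they are isomorphisms iff they are bijective.\<close>

definition homotopy_group :: "nat \<Rightarrow> 'a topology \<Rightarrow> 'a \<Rightarrow> ((nat \<Rightarrow> real) \<Rightarrow> 'a) set set" where
  "homotopy_group n X x = spheroids n X x // spheroid_homotopy n X x"

definition homotopy_group_map ::
    "nat \<Rightarrow> 'b topology \<Rightarrow> 'b \<Rightarrow> ('a \<Rightarrow> 'b) \<Rightarrow>
     ((nat \<Rightarrow> real) \<Rightarrow> 'a) set \<Rightarrow> ((nat \<Rightarrow> real) \<Rightarrow> 'b) set" where
  "homotopy_group_map n Y y f c = spheroid_homotopy n Y y `` ((\<lambda>h. f \<circ> h) ` c)"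

definition weak_homotopy_equivalence :: "'a topology \<Rightarrow> 'b topology \<Rightarrow> ('a \<Rightarrow> 'b) \<Rightarrow> bool" where
  "weak_homotopy_equivalence X Y f \<longleftrightarrow> continuous_map X Y f \<and>
     bij_betw (\<lambda>c. \<Union>x\<in>c. path_component_of_set Y (f x))
       (path_components_of X) (path_components_of Y) \<and>
     (\<forall>n \<ge> 1. \<forall>x \<in> topspace X.
        bij_betw (homotopy_group_map n Y (f x) f) (homotopy_group n X x) (homotopy_group n Y (f x)))"


section \<open>The categories are categories\<close>

lemma cat_hom_Top_P:
  "f \<in> cat_hom Top_P X Y \<longleftrightarrow> X \<in> Obj Top_P \<and> Y \<in> Obj Top_P \<and>
     (\<exists>a. f = Arrow X Y a \<and> strat_map X Y a \<and> a \<in> extensional (topspace (fst X)))"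
  by (cases f) (auto simp: Top_P_def cat_hom_def)

lemma cat_hom_sSet_P:
  "f \<in> cat_hom sSet_P K L \<longleftrightarrow> K \<in> Obj sSet_P \<and> L \<in> Obj sSet_P \<and>
     (\<exists>a. f = Arrow K L a \<and> simplicial_map (fst K) (fst L) a \<and>
        (\<forall>n. a n \<in> extensional (simps (fst K) n)) \<and>
        (\<forall>n. \<forall>x \<in> simps (fst K) n. snd L n (a n x) = snd K n x))"
  by (cases f) (auto simp: sSet_P_def cat_hom_def)

lemma category_Top_P: "category (Top_P :: (('u, 'p::order) strat_space, _) precategory)"
proof
  fix f :: "(('u, 'p) strat_space, 'u \<Rightarrow> 'u) arrow"
  assume "f \<in> Arr Top_P"
  then show "Dom Top_P f \<in> Obj Top_P \<and> Cod Top_P f \<in> Obj Top_P"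
    by (simp add: Top_P_def)
next
  fix X :: "('u, 'p) strat_space"
  assume X: "X \<in> Obj Top_P"
  have "continuous_map (fst X) (fst X) (restrict id (topspace (fst X)))"
    by (rule continuous_map_eq[OF continuous_map_id]) simp
  then have "strat_map X X (restrict id (topspace (fst X)))"
    by (simp add: strat_map_def)
  moreover have "Ident Top_P X = Arrow X X (restrict id (topspace (fst X)))"
    by (simp add: Top_P_def)
  ultimately show "Ident Top_P X \<in> cat_hom Top_P X X"
    using X by (simp add: cat_hom_Top_P)
next
  fix X Y Z :: "('u, 'p) strat_space" and f g
  assume f: "f \<in> cat_hom Top_P X Y" and g: "g \<in> cat_hom Top_P Y Z"
  from f obtain a where a: "f = Arrow X Y a" "strat_map X Y a"
    unfolding cat_hom_Top_P by blast
  from g obtain b where b: "g = Arrow Y Z b" "strat_map Y Z b"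
    unfolding cat_hom_Top_P by blast
  have "continuous_map (fst X) (fst Z) (b \<circ> a)"
    using a b by (auto simp: strat_map_def intro: continuous_map_compose)
  then have "continuous_map (fst X) (fst Z) (compose (topspace (fst X)) b a)"
    by (rule continuous_map_eq) (simp add: compose_def)
  moreover have "a x \<in> topspace (fst Y)" if "x \<in> topspace (fst X)" for x
    using a that continuous_map_funspace unfolding strat_map_def by blast
  ultimately have "strat_map X Z (compose (topspace (fst X)) b a)"
    using a b by (simp add: strat_map_def compose_def)
  moreover have "Comp Top_P g f = Arrow X Z (compose (topspace (fst X)) b a)"
    by (simp add: Top_P_def a b)
  ultimately show "Comp Top_P g f \<in> cat_hom Top_P X Z"
    using f g by (simp add: cat_hom_Top_P)
next
  fix X Y :: "('u, 'p) strat_space" and f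
  assume f: "f \<in> cat_hom Top_P X Y"
  then obtain a where a: "f = Arrow X Y a" "strat_map X Y a" "a \<in> extensional (topspace (fst X))"
    unfolding cat_hom_Top_P by blast
  have "a x \<in> topspace (fst Y)" if "x \<in> topspace (fst X)" for x
    using a that continuous_map_funspace unfolding strat_map_def by blast
  then have "compose (topspace (fst X)) (restrict id (topspace (fst Y))) a = a"
    using a(3) by (intro extensionalityI[where A = "topspace (fst X)"]) (simp_all add: compose_def)
  then show "Comp Top_P (Ident Top_P Y) f = f"
    by (simp add: Top_P_def a(1))
  have "compose (topspace (fst X)) a (restrict id (topspace (fst X))) = a"
    using a(3) by (intro extensionalityI[where A = "topspace (fst X)"]) (simp_all add: compose_def)
  then show "Comp Top_P f (Ident Top_P X) = f"
    by (simp add: Top_P_def a(1))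
next
  fix V X Y Z :: "('u, 'p) strat_space" and f g h
  assume "f \<in> cat_hom Top_P V X" and "g \<in> cat_hom Top_P X Y" and "h \<in> cat_hom Top_P Y Z"
  then obtain a b c where abc: "f = Arrow V X a" "g = Arrow X Y b" "h = Arrow Y Z c" "strat_map V X a"
    unfolding cat_hom_Top_P by blast
  have "a x \<in> topspace (fst X)" if "x \<in> topspace (fst V)" for x
    using abc(4) that continuous_map_funspace unfolding strat_map_def by blast
  then have "compose (topspace (fst V)) c (compose (topspace (fst V)) b a) =
      compose (topspace (fst V)) (compose (topspace (fst X)) c b) a"
    by (intro extensionalityI[where A = "topspace (fst V)"]) (simp_all add: compose_def)
  then show "Comp Top_P h (Comp Top_P g f) = Comp Top_P (Comp Top_P h g) f"
    by (simp add: Top_P_def abc(1-3))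
qed

lemma category_sSet_P: "category (sSet_P :: (('u, 'p::order) strat_sset, _) precategory)"
proof
  fix f :: "(('u, 'p) strat_sset, nat \<Rightarrow> 'u \<Rightarrow> 'u) arrow"
  assume "f \<in> Arr sSet_P"
  then show "Dom sSet_P f \<in> Obj sSet_P \<and> Cod sSet_P f \<in> Obj sSet_P"
    by (simp add: sSet_P_def)
next
  fix X :: "('u, 'p) strat_sset"
  assume X: "X \<in> Obj sSet_P"
  have "act (fst X) m n \<alpha> \<in> simps (fst X) n \<rightarrow> simps (fst X) m" if "\<alpha> \<in> Delta_maps m n" for m n \<alpha>
    using X that by (simp add: sSet_P_def stratified_sset_def simplicial_set_def)
  then have "simplicial_map (fst X) (fst X) (\<lambda>n. restrict id (simps (fst X) n))"
    by (simp add: simplicial_map_def Pi_iff)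
  moreover have "Ident sSet_P X = Arrow X X (\<lambda>n. restrict id (simps (fst X) n))"
    by (simp add: sSet_P_def)
  ultimately show "Ident sSet_P X \<in> cat_hom sSet_P X X"
    using X by (simp add: cat_hom_sSet_P)
next
  fix X Y Z :: "('u, 'p) strat_sset" and f g
  assume f: "f \<in> cat_hom sSet_P X Y" and g: "g \<in> cat_hom sSet_P Y Z"
  from f obtain a where a: "f = Arrow X Y a" "simplicial_map (fst X) (fst Y) a"
      "\<forall>n. \<forall>x \<in> simps (fst X) n. snd Y n (a n x) = snd X n x"
    unfolding cat_hom_sSet_P by blast
  from g obtain b where b: "g = Arrow Y Z b" "simplicial_map (fst Y) (fst Z) b"
      "\<forall>n. \<forall>x \<in> simps (fst Y) n. snd Z n (b n x) = snd Y n x"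
    unfolding cat_hom_sSet_P by blast
  have "act (fst X) m n \<alpha> x \<in> simps (fst X) m"
    if "\<alpha> \<in> Delta_maps m n" "x \<in> simps (fst X) n" for m n \<alpha> x
    using f that by (auto simp: cat_hom_def sSet_P_def stratified_sset_def simplicial_set_def)
  moreover have "a n x \<in> simps (fst Y) n" if "x \<in> simps (fst X) n" for n x
    using a(2) that unfolding simplicial_map_def by blast
  moreover have "b n x \<in> simps (fst Z) n" if "x \<in> simps (fst Y) n" for n x
    using b(2) that unfolding simplicial_map_def by blast
  ultimately have "simplicial_map (fst X) (fst Z) (\<lambda>n. compose (simps (fst X) n) (b n) (a n))"
      "\<forall>n. \<forall>x \<in> simps (fst X) n. snd Z n (compose (simps (fst X) n) (b n) (a n) x) = snd X n x"
    using a(2,3) b(2,3) by (simp_all add: simplicial_map_def compose_def)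
  moreover have "Comp sSet_P g f = Arrow X Z (\<lambda>n. compose (simps (fst X) n) (b n) (a n))"
    by (simp add: sSet_P_def a b)
  ultimately show "Comp sSet_P g f \<in> cat_hom sSet_P X Z"
    using f g by (simp add: cat_hom_sSet_P)
next
  fix X Y :: "('u, 'p) strat_sset" and f
  assume f: "f \<in> cat_hom sSet_P X Y"
  then obtain a where a: "f = Arrow X Y a" "simplicial_map (fst X) (fst Y) a"
      "\<forall>n. a n \<in> extensional (simps (fst X) n)"
    unfolding cat_hom_sSet_P by blast
  have "a n x \<in> simps (fst Y) n" if "x \<in> simps (fst X) n" for n x
    using a(2) that unfolding simplicial_map_def by blast
  then have "compose (simps (fst X) n) (restrict id (simps (fst Y) n)) (a n) = a n" for n
    using a(3) by (intro extensionalityI[where A = "simps (fst X) n"]) (simp_all add: compose_def)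
  then show "Comp sSet_P (Ident sSet_P Y) f = f"
    by (simp add: sSet_P_def a(1))
  have "compose (simps (fst X) n) (a n) (restrict id (simps (fst X) n)) = a n" for n
    using a(3) by (intro extensionalityI[where A = "simps (fst X) n"]) (simp_all add: compose_def)
  then show "Comp sSet_P f (Ident sSet_P X) = f"
    by (simp add: sSet_P_def a(1))
next
  fix V X Y Z :: "('u, 'p) strat_sset" and f g h
  assume "f \<in> cat_hom sSet_P V X" and "g \<in> cat_hom sSet_P X Y" and "h \<in> cat_hom sSet_P Y Z"
  then obtain a b c where abc: "f = Arrow V X a" "g = Arrow X Y b" "h = Arrow Y Z c"
      "simplicial_map (fst V) (fst X) a"
    unfolding cat_hom_sSet_P by blast
  have "a n x \<in> simps (fst X) n" if "x \<in> simps (fst V) n" for n x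
    using abc(4) that unfolding simplicial_map_def by blast
  then have "compose (simps (fst V) n) (c n) (compose (simps (fst V) n) (b n) (a n)) =
      compose (simps (fst V) n) (compose (simps (fst X) n) (c n) (b n)) (a n)" for n
    by (intro extensionalityI[where A = "simps (fst V) n"]) (simp_all add: compose_def)
  then show "Comp sSet_P h (Comp sSet_P g f) = Comp sSet_P (Comp sSet_P h g) f"
    by (simp add: sSet_P_def abc(1-3))
qed

end

theory Submission
  imports Defs "HOL-Analysis.Further_Topology"
begin

text \<open>
  In a model structure the acyclic cofibrations lift against the fibrations, and the conditions
  on the three classes force this lifting to create exit paths that an acyclic cofibration is not
  allowed to create.

  Fix \<open>p < q\<close> and stratify the tetrahedron with the vertices \<open>0, 1\<close> in \<open>p\<close> and \<open>2, 3\<close> in \<open>q\<close>. Let the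
  horn be the union of the faces opposite to \<open>0\<close>, \<open>2\<close> and \<open>3\<close>. Pushing vertex \<open>0\<close> linearly onto
  vertex \<open>1\<close> deforms the tetrahedron into the horn, preserves the horn and leaves the coordinates of
  the vertices \<open>2, 3\<close> alone; so the inclusion of the horn is a stratified homotopy equivalence,
  although the exit paths from vertex \<open>0\<close> inside the horn fall into two classes, according to the
  face (opposite to \<open>3\<close> or to \<open>2\<close>) in which they start, whereas in the tetrahedron one can cross from
  one class to the other arbitrarily close to vertex \<open>0\<close>. The inclusion is thus an acyclic
  cofibration.

  Now attach loops \<open>z\<^sub>0, z\<^sub>1, z\<^sub>2, \<dots>\<close> to the horn that accumulate at vertex \<open>0\<close>, the even ones along the
  edge from \<open>0\<close> to \<open>2\<close> and the odd ones along the edge from \<open>0\<close> to \<open>3\<close>. Call the result \<open>X\<close>, and let \<open>W\<close> be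
  the tetrahedron with the same loops attached at the same heights. Factor the inclusion of \<open>X\<close> in \<open>W\<close>
  into an acyclic cofibration \<open>X \<rightarrow> Z\<close> and a fibration \<open>Z \<rightarrow> W\<close>. The horn
  in \<open>X\<close> extends to a tetrahedron in \<open>Z\<close> over \<open>W\<close>. Hence \<open>Z\<close> contains an exit path at vertex \<open>0\<close> that runs through
  every loop exactly once: it uses the loops of \<open>X\<close>, and between them it crosses through the
  tetrahedron from one edge to the other. This spiral is continuous because the loops and
  the crossings both shrink to vertex \<open>0\<close>.

  By the condition on homotopy links the spiral can be connected in the homotopy link of \<open>Z\<close>, hence
  in that of \<open>W\<close>, to a path \<open>\<gamma>\<close> that comes from \<open>X\<close>. But an exit path of \<open>X\<close> starts on one of the
  two sides and therefore avoids all but finitely many of the even loops, or all but finitely many of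
  the odd ones (lemma \<open>link_path_avoids_loops\<close>). During the homotopy the end points of the paths
  stay at a positive height, where only finitely many loops exist; so for \<open>k\<close> large the winding
  number around the \<open>k\<close>-th loop is constant (lemma \<open>no_unwinding\<close>). It is \<open>1\<close> for the spiral,
  and \<open>0\<close> for \<open>\<gamma>\<close> for infinitely many \<open>k\<close>.

  All four spaces are realized inside one ambient space of pairs \<open>(t, z)\<close>, a point of the
  tetrahedron with a sequence of points of the circle, so that all maps except those in and out
  of \<open>Z\<close> are inclusions.
\<close>

section \<open>Delta-generated spaces\<close>

lemma topspace_delta_ification [simp]: "topspace (delta_ification X) = topspace X"
proof
  show "topspace (delta_ification X) \<subseteq> topspace X"
    using openin_delta_ification[of X "topspace (delta_ification X)"] by simp
  have "openin (simplex_topology n) {t \<in> standard_simplex n. \<sigma> t \<in> topspace X}"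
    if "singular_simplex n X \<sigma>" for n \<sigma>
  proof -
    have "\<sigma> t \<in> topspace X" if "t \<in> standard_simplex n" for t
      using \<open>singular_simplex n X \<sigma>\<close> that
      unfolding singular_simplex_def continuous_map_def by auto
    then have "{t \<in> standard_simplex n. \<sigma> t \<in> topspace X} = topspace (simplex_topology n)"
      by auto
    then show ?thesis by (metis openin_topspace)
  qed
  then have "openin (delta_ification X) (topspace X)"
    by (simp add: openin_delta_ification)
  then show "topspace X \<subseteq> topspace (delta_ification X)"
    by (rule openin_subset)
qed

lemma openin_delta_ificationI: "openin X U \<Longrightarrow> openin (delta_ification X) U"
  unfolding openin_delta_ification singular_simplex_def continuous_map_def
  using openin_subset by fastforce

lemma continuous_map_from_delta_ification:
  "continuous_map X Y f \<Longrightarrow> continuous_map (delta_ification X) Y f"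
  by (simp add: continuous_map_def openin_delta_ificationI)

lemma continuous_map_into_delta_ificationD:
  "continuous_map S (delta_ification X) f \<Longrightarrow> continuous_map S X f"
  using continuous_map_compose[OF _ continuous_map_from_delta_ification[OF continuous_map_id]]
  by fastforce

lemma continuous_map_into_delta_ification:
  assumes S: "delta_generated S" and f: "continuous_map S X f"
  shows "continuous_map S (delta_ification X) f"
  unfolding continuous_map_def
proof (intro conjI allI impI)
  show "f \<in> topspace S \<rightarrow> topspace (delta_ification X)"
    using f by (simp add: continuous_map_def)
  fix U assume U: "openin (delta_ification X) U"
  have "openin (simplex_topology n) {t \<in> standard_simplex n. \<sigma> t \<in> {x \<in> topspace S. f x \<in> U}}"
    if \<sigma>: "singular_simplex n S \<sigma>" for n \<sigma>
  proof -
    have "continuous_map (simplex_topology n) X (f \<circ> \<sigma>)"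
      using \<sigma> f by (auto simp: singular_simplex_def intro: continuous_map_compose)
    then have "singular_simplex n X (restrict (f \<circ> \<sigma>) (standard_simplex n))"
      unfolding singular_simplex_def by (auto intro: continuous_map_eq)
    then have "openin (simplex_topology n)
        {t \<in> standard_simplex n. restrict (f \<circ> \<sigma>) (standard_simplex n) t \<in> U}"
      using U unfolding openin_delta_ification by blast
    moreover have "\<sigma> t \<in> topspace S" if "t \<in> standard_simplex n" for t
      using \<sigma> that unfolding singular_simplex_def continuous_map_def by auto
    then have "{t \<in> standard_simplex n. \<sigma> t \<in> {x \<in> topspace S. f x \<in> U}} =
        {t \<in> standard_simplex n. restrict (f \<circ> \<sigma>) (standard_simplex n) t \<in> U}" by auto
    ultimately show ?thesis by simp
  qed
  then have "openin (delta_ification S) {x \<in> topspace S. f x \<in> U}"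
    by (simp add: openin_delta_ification)
  then show "openin S {x \<in> topspace S. f x \<in> U}"
    using S by (simp add: delta_generated_def)
qed

lemma delta_generatedI:
  assumes "\<And>U. \<lbrakk>U \<subseteq> topspace X;
      \<And>n \<sigma>. singular_simplex n X \<sigma> \<Longrightarrow>
        openin (simplex_topology n) {t \<in> standard_simplex n. \<sigma> t \<in> U}\<rbrakk> \<Longrightarrow> openin X U"
  shows "delta_generated X"
  unfolding delta_generated_def topology_eq
proof (intro allI iffI)
  fix U assume "openin (delta_ification X) U"
  then show "openin X U"
    unfolding openin_delta_ification by (intro assms) (elim conjE, simp)+
qed (rule openin_delta_ificationI)

lemma delta_generated_simplex: "delta_generated (simplex_topology n)"
proof (rule delta_generatedI)
  fix U assume U: "U \<subseteq> topspace (simplex_topology n)"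
    and o: "\<And>m \<sigma>. singular_simplex m (simplex_topology n) \<sigma> \<Longrightarrow>
        openin (simplex_topology m) {t \<in> standard_simplex m. \<sigma> t \<in> U}"
  have "continuous_map (simplex_topology n) (simplex_topology n) (restrict id (standard_simplex n))"
    by (rule continuous_map_eq[OF continuous_map_id]) simp
  then have "singular_simplex n (simplex_topology n) (restrict id (standard_simplex n))"
    by (simp add: singular_simplex_def)
  from o[OF this]
  have "openin (simplex_topology n) {t \<in> standard_simplex n. restrict id (standard_simplex n) t \<in> U}" .
  also have "{t \<in> standard_simplex n. restrict id (standard_simplex n) t \<in> U} = U"
    using U by auto
  finally show "openin (simplex_topology n) U" .
qed

lemma delta_generated_delta_ification: "delta_generated (delta_ification X)"
proof (rule delta_generatedI)
  fix U assume U: "U \<subseteq> topspace (delta_ification X)"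
    and o: "\<And>n \<sigma>. singular_simplex n (delta_ification X) \<sigma> \<Longrightarrow>
        openin (simplex_topology n) {t \<in> standard_simplex n. \<sigma> t \<in> U}"
  show "openin (delta_ification X) U"
    unfolding openin_delta_ification
  proof (intro conjI allI impI)
    fix n \<sigma> assume "singular_simplex n X \<sigma>"
    then have "singular_simplex n (delta_ification X) \<sigma>"
      using continuous_map_into_delta_ification[OF delta_generated_simplex]
      unfolding singular_simplex_def by blast
    then show "openin (simplex_topology n) {t \<in> standard_simplex n. \<sigma> t \<in> U}"
      by (rule o)
  qed (use U in simp)
qed

lemma delta_generated_homeomorphic_map:
  assumes X: "delta_generated X" and h: "homeomorphic_map X Y h"
  shows "delta_generated Y"
proof -
  obtain k where k: "homeomorphic_maps X Y h k"
    using h homeomorphic_map_maps by blast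
  have "continuous_map X (delta_ification Y) h"
    using continuous_map_into_delta_ification[OF X] k unfolding homeomorphic_maps_def by blast
  moreover have "continuous_map Y X k" "\<And>y. y \<in> topspace Y \<Longrightarrow> h (k y) = y"
    using k by (auto simp: homeomorphic_maps_def)
  ultimately have id: "continuous_map Y (delta_ification Y) id"
    by (intro continuous_map_eq[OF continuous_map_compose[of Y X k _ h]]) simp_all
  have "openin Y U" if "openin (delta_ification Y) U" for U
  proof -
    have "U \<subseteq> topspace Y" using that openin_subset by fastforce
    then have "{x \<in> topspace Y. id x \<in> U} = U" by auto
    then show ?thesis using openin_continuous_map_preimage[OF id that] by simp
  qed
  then show ?thesis
    unfolding delta_generated_def topology_eq using openin_delta_ificationI by blast
qed

text \<open>The interval is a simplex, so paths into a space and paths into its Delta-generated refinement agree.\<close>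
lemma delta_generated_unit_interval: "delta_generated (top_of_set {0..1::real})"
proof (rule delta_generated_homeomorphic_map[OF delta_generated_simplex])
  define k :: "real \<Rightarrow> nat \<Rightarrow> real"
    where "k s = (\<lambda>i. if i = 0 then s else if i = 1 then 1 - s else 0)" for s
  have 1: "continuous_map (simplex_topology 1) (top_of_set {0..1}) (\<lambda>t. t 0)"
    by (auto simp: continuous_map_in_subtopology standard_simplex_def
        intro!: continuous_map_from_subtopology continuous_map_product_projection)
  have "continuous_on {0..1} (\<lambda>s. k s i)" for i
    by (cases "i = 0"; cases "i = 1") (simp_all add: k_def continuous_intros)
  moreover have "k s \<in> standard_simplex 1" if "s \<in> {0..1}" for s
    using that by (auto simp: k_def standard_simplex_def)
  ultimately have 2: "continuous_map (top_of_set {0..1}) (simplex_topology 1) k"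
    by (auto simp: continuous_map_in_subtopology continuous_map_componentwise_UNIV)
  have "k (t 0) = t" if "t \<in> standard_simplex 1" for t
    using that by (auto simp: k_def standard_simplex_def)
  then have "homeomorphic_maps (simplex_topology 1) (top_of_set {0..1}) (\<lambda>t. t 0) k"
    using 1 2 by (auto simp: homeomorphic_maps_def k_def)
  then show "homeomorphic_map (simplex_topology 1) (top_of_set {0..1}) (\<lambda>t. t 0)"
    using homeomorphic_map_maps by blast
qed


section \<open>Transport of a topology along an injection\<close>

definition push_top :: "('a \<Rightarrow> 'u) \<Rightarrow> 'a topology \<Rightarrow> 'u topology" where
  "push_top e X = pullback_topology (range e) (inv_into UNIV e) X"

lemma topspace_push_top: "inj e \<Longrightarrow> topspace (push_top e X) = e ` topspace X"
  by (auto simp: push_top_def topspace_pullback_topology)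

lemma continuous_map_push_top_inv: "inj e \<Longrightarrow> continuous_map (push_top e X) X (inv_into UNIV e)"
  using continuous_map_pullback[OF continuous_map_id]
  by (fastforce simp: push_top_def)

lemma continuous_map_push_top: "inj e \<Longrightarrow> continuous_map X (push_top e X) e"
  unfolding push_top_def
  by (rule continuous_map_pullback')
     (auto intro: continuous_map_eq[OF continuous_map_id])

lemma homeomorphic_maps_push_top: "inj e \<Longrightarrow> homeomorphic_maps X (push_top e X) e (inv_into UNIV e)"
  by (auto simp: homeomorphic_maps_def continuous_map_push_top continuous_map_push_top_inv
      topspace_push_top)

section \<open>Realizations of simplicial sets\<close>

lemma continuous_map_characteristic:
  assumes "x \<in> simps K n"
  shows "continuous_map (simplex_topology n) (realization K) (\<lambda>t. gluing_equiv K `` {(n, x, t)})"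
  using assms
  by (auto simp: continuous_map_def openin_realization topspace_realization cell_points_def
      intro: quotientI)

lemma realization_cases:
  assumes "\<xi> \<in> topspace (realization K)"
  obtains n x t where "x \<in> simps K n" "t \<in> standard_simplex n"
    "\<xi> = gluing_equiv K `` {(n, x, t)}"
  using assms by (auto simp: topspace_realization cell_points_def elim!: quotientE)

lemma continuous_map_from_realization:
  assumes "\<And>n x. x \<in> simps K n \<Longrightarrow>
    continuous_map (simplex_topology n) Y (\<lambda>t. f (gluing_equiv K `` {(n, x, t)}))"
  shows "continuous_map (realization K) Y f"
  unfolding continuous_map_def
proof (intro conjI allI impI)
  show "f \<in> topspace (realization K) \<rightarrow> topspace Y"
  proof
    fix \<xi> assume "\<xi> \<in> topspace (realization K)"
    then obtain n x t where "x \<in> simps K n" "t \<in> standard_simplex n"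
      "\<xi> = gluing_equiv K `` {(n, x, t)}" by (rule realization_cases)
    then show "f \<xi> \<in> topspace Y"
      using continuous_map_funspace[OF assms, of x n] by auto
  qed
  fix U assume U: "openin Y U"
  have "openin (simplex_topology n) {t \<in> standard_simplex n.
      gluing_equiv K `` {(n, x, t)} \<in> {\<xi> \<in> topspace (realization K). f \<xi> \<in> U}}"
    if x: "x \<in> simps K n" for n x
  proof -
    have "openin (simplex_topology n)
        {t \<in> topspace (simplex_topology n). f (gluing_equiv K `` {(n, x, t)}) \<in> U}"
      using assms[OF x] U by (rule openin_continuous_map_preimage)
    moreover have "{t \<in> standard_simplex n.
        gluing_equiv K `` {(n, x, t)} \<in> {\<xi> \<in> topspace (realization K). f \<xi> \<in> U}} =
        {t \<in> topspace (simplex_topology n). f (gluing_equiv K `` {(n, x, t)}) \<in> U}"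
      using continuous_map_funspace[OF continuous_map_characteristic[OF x]] by auto
    ultimately show ?thesis by simp
  qed
  moreover have "{\<xi> \<in> topspace (realization K). f \<xi> \<in> U} \<subseteq> cell_points K // gluing_equiv K"
    using topspace_realization by blast
  ultimately show "openin (realization K) {\<xi> \<in> topspace (realization K). f \<xi> \<in> U}"
    unfolding openin_realization by blast
qed

lemma delta_generated_realization: "delta_generated (realization K)"
proof (rule delta_generatedI)
  fix U assume U: "U \<subseteq> topspace (realization K)"
    and o: "\<And>n \<sigma>. singular_simplex n (realization K) \<sigma> \<Longrightarrow>
        openin (simplex_topology n) {t \<in> standard_simplex n. \<sigma> t \<in> U}"
  have "openin (simplex_topology n) {t \<in> standard_simplex n. gluing_equiv K `` {(n, x, t)} \<in> U}"
    if x: "x \<in> simps K n" for n x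
  proof -
    let ?\<sigma> = "restrict (\<lambda>t. gluing_equiv K `` {(n, x, t)}) (standard_simplex n)"
    have "singular_simplex n (realization K) ?\<sigma>"
      unfolding singular_simplex_def
      by (intro conjI continuous_map_eq[OF continuous_map_characteristic[OF x]]) simp_all
    from o[OF this]
    have "openin (simplex_topology n) {t \<in> standard_simplex n. ?\<sigma> t \<in> U}" .
    also have "{t \<in> standard_simplex n. ?\<sigma> t \<in> U} =
        {t \<in> standard_simplex n. gluing_equiv K `` {(n, x, t)} \<in> U}" by auto
    finally show ?thesis .
  qed
  then show "openin (realization K) U"
    using U topspace_realization unfolding openin_realization by blast
qed

lemma gluing_equivI:
  assumes "a \<in> cell_points K" "b \<in> cell_points K" "(a, b) \<in> (gluing K \<union> (gluing K)\<inverse>)\<^sup>*"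
  shows "(a, b) \<in> gluing_equiv K"
  using assms by (simp add: gluing_equiv_def)

lemma realization_map_class:
  assumes f: "simplicial_map K L f" and a: "(n, x, t) \<in> cell_points K"
  shows "realization_map L f (gluing_equiv K `` {(n, x, t)}) = gluing_equiv L `` {(n, f n x, t)}"
proof -
  define \<phi> where "\<phi> = (\<lambda>(n, x, t :: nat \<Rightarrow> real). (n :: nat, f n x, t))"
  have cells: "\<phi> b \<in> cell_points L" if "b \<in> cell_points K" for b
    using that f by (auto simp: \<phi>_def cell_points_def simplicial_map_def)
  have step: "(\<phi> b, \<phi> c) \<in> gluing L" if "(b, c) \<in> gluing K" for b c
    using that f by (fastforce simp: \<phi>_def gluing_def simplicial_map_def)
  have "(\<phi> b, \<phi> c) \<in> (gluing L \<union> (gluing L)\<inverse>)\<^sup>*"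
    if "(b, c) \<in> (gluing K \<union> (gluing K)\<inverse>)\<^sup>*" for b c
    using that by (induction rule: rtrancl_induct)
      (auto intro: rtrancl_into_rtrancl dest!: step)
  then have rel: "(\<phi> b, \<phi> c) \<in> gluing_equiv L" if "(b, c) \<in> gluing_equiv K" for b c
    using that cells by (auto simp: gluing_equiv_def)
  have eq: "equiv (cell_points L) (gluing_equiv L)" by (rule equiv_gluing_equiv)
  have self: "(n, x, t) \<in> gluing_equiv K `` {(n, x, t)}"
    using equiv_class_self[OF equiv_gluing_equiv a] .
  have "gluing_equiv L `` (\<phi> ` (gluing_equiv K `` {(n, x, t)})) = gluing_equiv L `` {\<phi> (n, x, t)}"
  proof
    show "gluing_equiv L `` (\<phi> ` (gluing_equiv K `` {(n, x, t)})) \<subseteq> gluing_equiv L `` {\<phi> (n, x, t)}"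
      using rel eq unfolding equiv_def trans_def by blast
    show "gluing_equiv L `` {\<phi> (n, x, t)} \<subseteq> gluing_equiv L `` (\<phi> ` (gluing_equiv K `` {(n, x, t)}))"
      using self by blast
  qed
  then show ?thesis by (simp add: realization_map_def \<phi>_def)
qed


section \<open>Affine maps between simplices\<close>

lemma simplex_push_in_simplex:
  assumes \<alpha>: "\<alpha> \<in> Delta_maps m n" and t: "t \<in> standard_simplex m"
  shows "simplex_push m \<alpha> t \<in> standard_simplex n"
proof -
  have t0: "0 \<le> t i" for i
    using t by (auto simp: standard_simplex_def)
  have t1: "(\<Sum>i\<le>m. t i) = 1"
    using t by (auto simp: standard_simplex_def)
  have \<alpha>n: "\<alpha> i \<le> n" if "i \<le> m" for i
    using \<alpha> that by (auto simp: Delta_maps_def)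
  have "(\<Sum>i | i \<le> m \<and> \<alpha> i = j. t i) \<le> (\<Sum>i\<le>m. t i)" for j
    by (rule sum_mono2) (auto simp: t0)
  moreover have "(\<Sum>j\<le>n. \<Sum>i | i \<le> m \<and> \<alpha> i = j. t i) = (\<Sum>i\<le>m. t i)"
    using sum.group[of "{..m}" "{..n}" \<alpha> t] \<alpha>n by auto
  moreover have "{i. i \<le> m \<and> \<alpha> i = j} = {}" if "j > n" for j
    using \<alpha>n that by fastforce
  then have "(\<Sum>i | i \<le> m \<and> \<alpha> i = j. t i) = 0" if "j > n" for j
    using that by (metis sum.empty)
  ultimately show ?thesis
    by (auto simp: standard_simplex_def simplex_push_def t1 intro: sum_nonneg t0)
qed

lemma simplex_push_compose:
  assumes \<alpha>: "\<alpha> \<in> Delta_maps m n"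
  shows "simplex_push m (compose {..m} \<sigma> \<alpha>) t = simplex_push n \<sigma> (simplex_push m \<alpha> t)"
proof
  fix j
  have "(\<Sum>l | l \<le> n \<and> \<sigma> l = j. \<Sum>i | i \<le> m \<and> \<alpha> i = l. t i)
      = (\<Sum>l\<in>{l. l \<le> n \<and> \<sigma> l = j}. \<Sum>i\<in>{i\<in>{i. i \<le> m \<and> \<sigma> (\<alpha> i) = j}. \<alpha> i = l}. t i)"
    by (intro sum.cong) auto
  also have "\<dots> = (\<Sum>i | i \<le> m \<and> \<sigma> (\<alpha> i) = j. t i)"
    using \<alpha> by (intro sum.group) (auto simp: Delta_maps_def)
  also have "\<dots> = (\<Sum>i | i \<le> m \<and> compose {..m} \<sigma> \<alpha> i = j. t i)"
    by (intro sum.cong) (auto simp: compose_def)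
  finally show "simplex_push m (compose {..m} \<sigma> \<alpha>) t j = simplex_push n \<sigma> (simplex_push m \<alpha> t) j"
    by (simp add: simplex_push_def)
qed

lemma simplex_push_fix:
  assumes t: "t \<in> standard_simplex m" and fx: "\<And>i. t i \<noteq> 0 \<Longrightarrow> \<alpha> i = i"
  shows "simplex_push m \<alpha> t = t"
proof
  fix j
  have le: "i \<le> m" if "t i \<noteq> 0" for i
    using t that by (auto simp: standard_simplex_def not_le[symmetric])
  show "simplex_push m \<alpha> t j = t j"
  proof (cases "t j = 0")
    case True
    then have "(\<Sum>i | i \<le> m \<and> \<alpha> i = j. t i) = 0"
      by (intro sum.neutral) (metis (mono_tags, lifting) fx mem_Collect_eq)
    then show ?thesis using True by (simp add: simplex_push_def)
  next
    case False
    then have "(\<Sum>i | i \<le> m \<and> \<alpha> i = j. t i) = (\<Sum>i\<in>{j}. t i)"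
      using fx le by (intro sum.mono_neutral_right) auto
    then show ?thesis by (simp add: simplex_push_def)
  qed
qed

abbreviation supp :: "(nat \<Rightarrow> real) \<Rightarrow> nat set" where
  "supp t \<equiv> {i. t i \<noteq> 0}"

lemma supp_le: "t \<in> standard_simplex n \<Longrightarrow> t i \<noteq> 0 \<Longrightarrow> i \<le> n"
  by (auto simp: standard_simplex_def not_le[symmetric])

lemma supp_subset: "t \<in> standard_simplex n \<Longrightarrow> supp t \<subseteq> {..n}"
  using supp_le by auto

lemma supp_nonempty: "t \<in> standard_simplex n \<Longrightarrow> supp t \<noteq> {}"
  by (force simp: standard_simplex_def)

lemma supp_simplex_push:
  assumes t: "t \<in> standard_simplex m"
  shows "supp (simplex_push m \<alpha> t) = \<alpha> ` supp t"
proof -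
  have t0: "0 \<le> t i" for i using t by (auto simp: standard_simplex_def)
  have "simplex_push m \<alpha> t j \<noteq> 0 \<longleftrightarrow> (\<exists>i. i \<le> m \<and> \<alpha> i = j \<and> t i \<noteq> 0)" for j
    unfolding simplex_push_def using t0 by (subst sum_nonneg_eq_0_iff) auto
  then show ?thesis using supp_le[OF t] by auto
qed

lemma continuous_map_simplex_push:
  "continuous_map (simplex_topology n) (powertop_real UNIV) (simplex_push n \<alpha>)"
  unfolding continuous_map_componentwise_UNIV simplex_push_def
  by (auto intro!: continuous_map_sum continuous_map_from_subtopology
      continuous_map_product_projection)


text \<open>A monotone retraction of \<open>{..n}\<close> onto \<open>I\<close>. As \<open>snap n I\<close> is an \<open>n\<close>-simplex (usually degenerate) of the
  face spanned by \<open>I\<close>, it allows points of every face of the \<open>n\<close>-simplex to be named by \<open>n\<close>-simplices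
  and their unchanged barycentric coordinates, so that nondegenerate simplices are not needed.\<close>
definition snap :: "nat \<Rightarrow> nat set \<Rightarrow> nat \<Rightarrow> nat" where
  "snap n I = restrict (\<lambda>j. if {i \<in> I. i \<le> j} = {} then Min I else Max {i \<in> I. i \<le> j}) {..n}"

lemma snap_fix: "\<lbrakk>I \<subseteq> {..n}; i \<in> I\<rbrakk> \<Longrightarrow> snap n I i = i"
  by (auto simp: snap_def intro!: Max_eqI)

lemma snap_in:
  assumes "I \<subseteq> {..n}" "I \<noteq> {}" "j \<le> n"
  shows "snap n I j \<in> I"
proof -
  have "finite I" using assms(1) finite_subset by blast
  then show ?thesis
    using assms Max_in[of "{i \<in> I. i \<le> j}"] Min_in[of I] by (auto simp: snap_def)
qed

lemma snap_image:
  assumes I: "I \<subseteq> {..n}" "I \<noteq> {}"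
  shows "snap n I ` {..n} = I"
proof
  show "snap n I ` {..n} \<subseteq> I" using snap_in[OF I] by auto
  show "I \<subseteq> snap n I ` {..n}"
  proof
    fix i assume "i \<in> I"
    then show "i \<in> snap n I ` {..n}"
      using snap_fix[OF I(1)] I(1) by (intro image_eqI[of _ _ i]) auto
  qed
qed

lemma snap_Delta_maps:
  assumes I: "I \<subseteq> {..n}" "I \<noteq> {}"
  shows "snap n I \<in> Delta_maps n n"
proof -
  have fin: "finite I" using I(1) finite_subset by blast
  have "snap n I j \<le> snap n I k" if "j \<le> k" "k \<le> n" for j k
  proof (cases "{i \<in> I. i \<le> j} = {}")
    case True
    then have "snap n I j = Min I" using that by (simp add: snap_def)
    also have "\<dots> \<le> snap n I k" using snap_in[OF I that(2)] fin by simp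
    finally show ?thesis .
  next
    case False
    then have "Max {i \<in> I. i \<le> j} \<le> Max {i \<in> I. i \<le> k}"
      using fin that by (intro Max_mono) auto
    moreover have "{i \<in> I. i \<le> k} \<noteq> {}" using False that by auto
    ultimately show ?thesis using False that
      by (simp add: snap_def del: Collect_empty_eq empty_Collect_eq)
  qed
  moreover have "snap n I \<in> {..n} \<rightarrow>\<^sub>E {..n}"
    using snap_in[OF I] I(1) by (auto simp: snap_def)
  ultimately show ?thesis by (auto simp: Delta_maps_def mono_on_def)
qed

lemma compose_Delta_maps:
  assumes "\<alpha> \<in> Delta_maps l m" "\<sigma> \<in> Delta_maps m n"
  shows "compose {..l} \<sigma> \<alpha> \<in> Delta_maps l n"
  using assms by (fastforce simp: Delta_maps_def compose_def mono_on_def PiE_iff)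

section \<open>Subcomplexes of a simplex\<close>

text \<open>Simplices have to be elements of the universe, which is what the injection \<open>\<epsilon>\<close> is for.\<close>
definition faces_sset :: "((nat \<Rightarrow> nat) \<Rightarrow> 'u) \<Rightarrow> nat \<Rightarrow> nat set set \<Rightarrow> 'u sset" where
  "faces_sset \<epsilon> N D =
    \<lparr>simps = (\<lambda>n. \<epsilon> ` {\<sigma> \<in> Delta_maps n N. \<sigma> ` {..n} \<in> D}),
     act = (\<lambda>m n \<alpha> x. \<epsilon> (compose {..m} (inv_into UNIV \<epsilon> x) \<alpha>))\<rparr>"

definition faces_label ::
    "((nat \<Rightarrow> nat) \<Rightarrow> 'u) \<Rightarrow> (nat \<Rightarrow> 'p::order) \<Rightarrow> nat \<Rightarrow> 'u \<Rightarrow> nat \<Rightarrow> 'p" where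
  "faces_label \<epsilon> st n x = restrict (st \<circ> inv_into UNIV \<epsilon> x) {..n}"

definition faces_space :: "nat \<Rightarrow> nat set set \<Rightarrow> (nat \<Rightarrow> real) set" where
  "faces_space N D = {t \<in> standard_simplex N. supp t \<in> D}"

locale simplex_faces =
  fixes \<epsilon> :: "(nat \<Rightarrow> nat) \<Rightarrow> 'u" and N :: nat and D :: "nat set set"
    and st :: "nat \<Rightarrow> 'p::order"
  assumes inj_code: "inj \<epsilon>"
    and down_closed: "\<lbrakk>I \<in> D; J \<subseteq> I; J \<noteq> {}\<rbrakk> \<Longrightarrow> J \<in> D"
    and mono_label: "mono_on {..N} st"
begin

abbreviation K where "K \<equiv> faces_sset \<epsilon> N D"
abbreviation lab where "lab \<equiv> faces_label \<epsilon> st"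

lemma mem_simps: "x \<in> simps K n \<longleftrightarrow> (\<exists>\<sigma> \<in> Delta_maps n N. \<sigma> ` {..n} \<in> D \<and> x = \<epsilon> \<sigma>)"
  by (auto simp: faces_sset_def)

lemma act_code: "act K m n \<alpha> (\<epsilon> \<sigma>) = \<epsilon> (compose {..m} \<sigma> \<alpha>)"
  by (simp add: faces_sset_def inj_code)

lemma lab_code: "lab n (\<epsilon> \<sigma>) = restrict (st \<circ> \<sigma>) {..n}"
  by (simp add: faces_label_def inj_code)

lemma face_in_D:
  assumes "\<alpha> \<in> Delta_maps m n" "\<sigma> ` {..n} \<in> D"
  shows "compose {..m} \<sigma> \<alpha> ` {..m} \<in> D"
  by (rule down_closed[OF assms(2)]) (use assms(1) in \<open>auto simp: Delta_maps_def compose_def\<close>)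

lemma simplicial_set_faces: "simplicial_set K"
  unfolding simplicial_set_def
proof (intro conjI allI ballI)
  fix m n \<alpha> assume \<alpha>: "\<alpha> \<in> Delta_maps m n"
  show "act K m n \<alpha> \<in> simps K n \<rightarrow> simps K m"
  proof
    fix x assume "x \<in> simps K n"
    then obtain \<sigma> where \<sigma>: "\<sigma> \<in> Delta_maps n N" "\<sigma> ` {..n} \<in> D" "x = \<epsilon> \<sigma>"
      unfolding mem_simps by blast
    show "act K m n \<alpha> x \<in> simps K m"
      unfolding mem_simps \<sigma>(3) act_code
      using compose_Delta_maps[OF \<alpha> \<sigma>(1)] face_in_D[OF \<alpha> \<sigma>(2)] by blast
  qed
next
  fix n x assume "x \<in> simps K n"
  then obtain \<sigma> where \<sigma>: "\<sigma> \<in> Delta_maps n N" "x = \<epsilon> \<sigma>"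
    unfolding mem_simps by blast
  have "compose {..n} \<sigma> (restrict id {..n}) = \<sigma>"
    using \<sigma>(1) by (auto simp: Delta_maps_def compose_def fun_eq_iff PiE_def extensional_def)
  then show "act K n n (restrict id {..n}) x = x"
    unfolding \<sigma>(2) act_code by simp
next
  fix l m n \<beta> \<alpha> x
  assume \<beta>: "\<beta> \<in> Delta_maps l m" and \<alpha>: "\<alpha> \<in> Delta_maps m n" and "x \<in> simps K n"
  then obtain \<sigma> where \<sigma>: "x = \<epsilon> \<sigma>"
    unfolding mem_simps by blast
  have "compose {..l} (compose {..m} \<sigma> \<alpha>) \<beta> = compose {..l} \<sigma> (compose {..l} \<alpha> \<beta>)"
    using \<beta> by (auto simp: Delta_maps_def compose_def fun_eq_iff)
  then show "act K l m \<beta> (act K m n \<alpha> x) = act K l n (compose {..l} \<alpha> \<beta>) x"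
    unfolding \<sigma> act_code by simp
qed

lemma simplicial_map_label: "simplicial_map K nerve lab"
  unfolding simplicial_map_def
proof (intro conjI allI ballI)
  fix n show "lab n \<in> simps K n \<rightarrow> simps nerve n"
  proof
    fix x assume "x \<in> simps K n"
    then obtain \<sigma> where \<sigma>: "\<sigma> \<in> Delta_maps n N" "x = \<epsilon> \<sigma>"
      unfolding mem_simps by blast
    have "st (\<sigma> i) \<le> st (\<sigma> j)" if "i \<le> j" "j \<le> n" for i j
      using \<sigma>(1) that by (intro mono_onD[OF mono_label]) (auto simp: Delta_maps_def mono_on_def)
    then show "lab n x \<in> simps nerve n"
      by (auto simp: \<sigma>(2) lab_code nerve_def mono_on_def)
  qed
next
  fix m n \<alpha> x assume \<alpha>: "\<alpha> \<in> Delta_maps m n" and "x \<in> simps K n"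
  then obtain \<sigma> where \<sigma>: "x = \<epsilon> \<sigma>"
    unfolding mem_simps by blast
  show "lab m (act K m n \<alpha> x) = act nerve m n \<alpha> (lab n x)"
    using \<alpha> unfolding \<sigma> act_code lab_code
    by (auto simp: nerve_def compose_def fun_eq_iff Delta_maps_def restrict_def PiE_def Pi_def)
qed

lemma stratified_sset_faces: "stratified_sset (K, lab)"
  by (simp add: stratified_sset_def simplicial_set_faces simplicial_map_label)

definition position :: "'u cell_point \<Rightarrow> nat \<Rightarrow> real" where
  "position = (\<lambda>(n, x, t). simplex_push n (inv_into UNIV \<epsilon> x) t)"

lemma position_code: "position (n, \<epsilon> \<sigma>, t) = simplex_push n \<sigma> t"
  by (simp add: position_def inj_code)

text \<open>The normal form of a point of the realization, given by its position in the geometric simplex.\<close>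
definition standard_cell :: "(nat \<Rightarrow> real) \<Rightarrow> 'u cell_point" where
  "standard_cell t = (N, \<epsilon> (snap N (supp t)), t)"

lemma position_gluing_equiv:
  assumes "(a, b) \<in> gluing_equiv K"
  shows "position a = position b"
proof -
  have step: "position a = position b" if "(a, b) \<in> gluing K" for a b
    using that
    by (auto simp: gluing_def mem_simps act_code position_code simplex_push_compose)
  have "(a, b) \<in> (gluing K \<union> (gluing K)\<inverse>)\<^sup>*"
    using assms by (simp add: gluing_equiv_def)
  then show ?thesis
    by (induction rule: rtrancl_induct) (auto dest: step)
qed

lemma standard_cell_simplex:
  assumes "t \<in> faces_space N D"
  shows "\<epsilon> (snap N (supp t)) \<in> simps K N"
proof -
  have t: "supp t \<subseteq> {..N}" "supp t \<noteq> {}" "supp t \<in> D"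
    using assms supp_subset supp_nonempty by (auto simp: faces_space_def)
  show ?thesis
    unfolding mem_simps using snap_Delta_maps[OF t(1,2)] snap_image[OF t(1,2)] t(3)
    by (intro bexI[of _ "snap N (supp t)"]) simp_all
qed

lemma standard_cell_in: "t \<in> faces_space N D \<Longrightarrow> standard_cell t \<in> cell_points K"
  using standard_cell_simplex by (auto simp: standard_cell_def cell_points_def faces_space_def)

lemma position_standard_cell: "t \<in> faces_space N D \<Longrightarrow> position (standard_cell t) = t"
  unfolding standard_cell_def position_code
  by (rule simplex_push_fix) (use snap_fix supp_subset in \<open>auto simp: faces_space_def\<close>)

text \<open>Every cell is glued to its normal form in two steps: restricting the simplex to the support \<open>J\<close> of the
  coordinates (along \<open>snap m J\<close>, which fixes them) makes the image of the simplex equal to the support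
  \<open>I\<close> of the position, and then the simplex factors through \<open>snap N I\<close>.\<close>
lemma equiv_standard_cell:
  assumes "a \<in> cell_points K"
  shows "position a \<in> faces_space N D" "(a, standard_cell (position a)) \<in> gluing_equiv K"
proof -
  obtain m \<sigma> s where a: "a = (m, \<epsilon> \<sigma>, s)" and \<sigma>: "\<sigma> \<in> Delta_maps m N" "\<sigma> ` {..m} \<in> D"
    and s: "s \<in> standard_simplex m"
    using assms unfolding cell_points_def mem_simps by blast
  define J where "J = supp s"
  have J: "J \<subseteq> {..m}" "J \<noteq> {}"
    using supp_subset[OF s] supp_nonempty[OF s] by (auto simp: J_def)
  define \<rho> where "\<rho> = compose {..m} \<sigma> (snap m J)"
  have \<rho>: "\<rho> \<in> Delta_maps m N"
    unfolding \<rho>_def by (rule compose_Delta_maps[OF snap_Delta_maps[OF J] \<sigma>(1)])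
  have "\<rho> ` {..m} = \<sigma> ` (snap m J ` {..m})"
    by (auto simp: \<rho>_def compose_def)
  then have im: "\<rho> ` {..m} = \<sigma> ` J" by (simp add: snap_image[OF J])
  have pos: "position a = simplex_push m \<sigma> s" by (simp add: a position_code)
  have I: "supp (position a) = \<sigma> ` J"
    by (simp add: pos supp_simplex_push[OF s] J_def)
  have "\<sigma> ` J \<in> D" using \<sigma>(2) J by (intro down_closed[OF \<sigma>(2)]) auto
  then show p: "position a \<in> faces_space N D"
    using simplex_push_in_simplex[OF \<sigma>(1) s] I by (simp add: faces_space_def pos)
  have s': "simplex_push m (snap m J) s = s"
    by (rule simplex_push_fix[OF s]) (use snap_fix[OF J(1)] in \<open>auto simp: J_def\<close>)
  have "((m, act K m m (snap m J) (\<epsilon> \<sigma>), s), (m, \<epsilon> \<sigma>, simplex_push m (snap m J) s)) \<in> gluing K"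
    using \<sigma> s snap_Delta_maps[OF J] unfolding gluing_def mem_simps by blast
  then have 1: "((m, \<epsilon> \<rho>, s), a) \<in> gluing K"
    by (simp add: act_code \<rho>_def[symmetric] s' a)
  have "position a = simplex_push m \<rho> s"
    unfolding \<rho>_def simplex_push_compose[OF snap_Delta_maps[OF J]] s' by (rule pos)
  moreover have "compose {..m} (snap N (supp (position a))) \<rho> = \<rho>"
  proof
    fix i show "compose {..m} (snap N (supp (position a))) \<rho> i = \<rho> i"
    proof (cases "i \<le> m")
      case True
      then have "\<rho> i \<in> supp (position a)" using im I by blast
      moreover have "supp (position a) \<subseteq> {..N}"
        using p supp_subset by (auto simp: faces_space_def)
      ultimately show ?thesis using True snap_fix by (simp add: compose_def)
    next
      case False
      then show ?thesis by (simp add: compose_def \<rho>_def)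
    qed
  qed
  moreover have "((m, act K m N \<rho> (\<epsilon> (snap N (supp (position a)))), s),
      (N, \<epsilon> (snap N (supp (position a))), simplex_push m \<rho> s)) \<in> gluing K"
    using \<rho> s standard_cell_simplex[OF p] unfolding gluing_def by blast
  ultimately have 2: "((m, \<epsilon> \<rho>, s), standard_cell (position a)) \<in> gluing K"
    by (simp add: act_code standard_cell_def)
  have "(a, standard_cell (position a)) \<in> (gluing K \<union> (gluing K)\<inverse>)\<^sup>*"
    using 1 2 by (meson UnI1 UnI2 converse_iff converse_rtrancl_into_rtrancl r_into_rtrancl)
  then show "(a, standard_cell (position a)) \<in> gluing_equiv K"
    using assms standard_cell_in[OF p] by (rule gluing_equivI[rotated 2])
qed

definition class_position :: "'u cell_point set \<Rightarrow> nat \<Rightarrow> real" where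
  "class_position \<xi> = position (SOME a. a \<in> \<xi>)"

lemma class_position:
  assumes "a \<in> cell_points K"
  shows "class_position (gluing_equiv K `` {a}) = position a"
proof -
  have "a \<in> gluing_equiv K `` {a}" by (rule equiv_class_self[OF equiv_gluing_equiv assms])
  then have "(SOME b. b \<in> gluing_equiv K `` {a}) \<in> gluing_equiv K `` {a}" by (rule someI)
  then show ?thesis using position_gluing_equiv unfolding class_position_def by fastforce
qed

lemma class_standard_cell:
  assumes "\<xi> \<in> topspace (realization K)"
  shows "class_position \<xi> \<in> faces_space N D"
    "\<xi> = gluing_equiv K `` {standard_cell (class_position \<xi>)}"
proof -
  obtain a where a: "a \<in> cell_points K" "\<xi> = gluing_equiv K `` {a}"
    using assms by (auto simp: topspace_realization elim: quotientE)
  have c: "class_position \<xi> = position a" using class_position a by simp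
  then show "class_position \<xi> \<in> faces_space N D" using equiv_standard_cell a by simp
  show "\<xi> = gluing_equiv K `` {standard_cell (class_position \<xi>)}"
    unfolding a(2) c[unfolded a(2)]
    using equiv_standard_cell(2)[OF a(1)] equiv_class_eq[OF equiv_gluing_equiv] by metis
qed

lemma bij_betw_class_position:
  "bij_betw class_position (topspace (realization K)) (faces_space N D)"
proof (rule bij_betwI[where g = "\<lambda>t. gluing_equiv K `` {standard_cell t}"])
  show "class_position \<in> topspace (realization K) \<rightarrow> faces_space N D"
    using class_standard_cell(1) by blast
  show "(\<lambda>t. gluing_equiv K `` {standard_cell t}) \<in> faces_space N D \<rightarrow> topspace (realization K)"
    using standard_cell_in by (auto simp: topspace_realization intro: quotientI)
qed (use class_standard_cell(2) class_position standard_cell_in position_standard_cell in auto)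

lemma continuous_class_position:
  "continuous_map (realization K) (powertop_real UNIV) class_position"
proof (rule continuous_map_from_realization)
  fix n x assume x: "x \<in> simps K n"
  then obtain \<sigma> where "x = \<epsilon> \<sigma>" unfolding mem_simps by blast
  then have "class_position (gluing_equiv K `` {(n, x, t)}) = simplex_push n \<sigma> t"
    if "t \<in> standard_simplex n" for t
    using class_position[of "(n, x, t)"] x that by (simp add: cell_points_def position_code)
  then show "continuous_map (simplex_topology n) (powertop_real UNIV)
      (\<lambda>t. class_position (gluing_equiv K `` {(n, x, t)}))"
    by (intro continuous_map_eq[OF continuous_map_simplex_push]) simp
qed

text \<open>By the normal form, finitely many \<open>N\<close>-simplices \<open>snap N I\<close> cover the realization.\<close>
lemma compact_realization_faces: "compact_space (realization K)"
proof -
  define S where "S = {x \<in> simps K N. x \<in> (\<lambda>I. \<epsilon> (snap N I)) ` Pow {..N}}"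
  have "compactin (realization K) ((\<lambda>t. gluing_equiv K `` {(N, x, t)}) ` standard_simplex N)"
    if "x \<in> S" for x
    using that compactin_standard_simplex
    by (intro image_compactin[OF _ continuous_map_characteristic])
      (auto simp: compactin_subtopology S_def)
  moreover have "finite S" by (simp add: S_def)
  moreover have "topspace (realization K) =
      (\<Union>x\<in>S. (\<lambda>t. gluing_equiv K `` {(N, x, t)}) ` standard_simplex N)" (is "_ = ?R")
  proof
    show "topspace (realization K) \<subseteq> ?R"
    proof
      fix \<xi> assume \<xi>: "\<xi> \<in> topspace (realization K)"
      let ?t = "class_position \<xi>"
      have t: "?t \<in> faces_space N D" by (rule class_standard_cell(1)[OF \<xi>])
      then have t': "?t \<in> standard_simplex N" by (simp add: faces_space_def)
      have "\<epsilon> (snap N (supp ?t)) \<in> S"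
        using standard_cell_simplex[OF t] supp_subset[OF t'] by (auto simp: S_def)
      moreover have "\<xi> = gluing_equiv K `` {(N, \<epsilon> (snap N (supp ?t)), ?t)}"
        using class_standard_cell(2)[OF \<xi>] by (simp add: standard_cell_def)
      ultimately show "\<xi> \<in> ?R" using t' by blast
    qed
    show "?R \<subseteq> topspace (realization K)"
      by (auto simp: S_def topspace_realization cell_points_def intro: quotientI)
  qed
  ultimately show ?thesis
    unfolding compact_space_def by (auto intro: compactin_Union)
qed

text \<open>A continuous bijection from a compact space to a Hausdorff space.\<close>
lemma homeomorphic_class_position:
  "homeomorphic_map (realization K) (subtopology (powertop_real UNIV) (faces_space N D)) class_position"
proof (rule continuous_imp_homeomorphic_map)
  show "compact_space (realization K)" by (rule compact_realization_faces)
  show "Hausdorff_space (subtopology (powertop_real UNIV) (faces_space N D))"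
    by (simp add: Hausdorff_space_subtopology Hausdorff_space_product_topology)
  show "continuous_map (realization K) (subtopology (powertop_real UNIV) (faces_space N D)) class_position"
    using continuous_class_position class_standard_cell(1)
    by (auto simp: continuous_map_in_subtopology)
  show "class_position ` topspace (realization K) =
      topspace (subtopology (powertop_real UNIV) (faces_space N D))"
    using bij_betw_class_position by (simp add: bij_betw_def)
  show "inj_on class_position (topspace (realization K))"
    using bij_betw_class_position by (simp add: bij_betw_def)
qed

lemma realize_stratum:
  assumes "\<xi> \<in> topspace (realization K)"
  shows "snd (realize (K, lab)) \<xi> = st (Max (supp (class_position \<xi>)))"
proof -
  let ?t = "class_position \<xi>"
  have t: "?t \<in> faces_space N D" by (rule class_standard_cell(1)[OF assms])
  then have t': "?t \<in> standard_simplex N" by (simp add: faces_space_def)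
  have I: "supp ?t \<subseteq> {..N}" "supp ?t \<noteq> {}"
    using supp_subset[OF t'] supp_nonempty[OF t'] by auto
  have fin: "finite (supp ?t)" using I(1) finite_subset by blast
  have Mx: "Max (supp ?t) \<in> supp ?t" using Max_in[OF fin I(2)] .
  have cell: "(N, \<epsilon> (snap N (supp ?t)), ?t) \<in> cell_points K"
    using standard_cell_in[OF t] by (simp add: standard_cell_def)
  have "realization_map nerve lab \<xi> =
      gluing_equiv nerve `` {(N, lab N (\<epsilon> (snap N (supp ?t))), ?t)}"
    using realization_map_class[OF simplicial_map_label cell] class_standard_cell(2)[OF assms]
    by (simp add: standard_cell_def)
  moreover have "(N, lab N (\<epsilon> (snap N (supp ?t))), ?t) \<in> cell_points nerve"
    using cell simplicial_map_label by (auto simp: cell_points_def simplicial_map_def)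
  moreover have "{i. i \<le> N \<and> ?t i \<noteq> 0} = supp ?t" using I(1) by auto
  ultimately have "nerve_strat (realization_map nerve lab \<xi>) =
      lab N (\<epsilon> (snap N (supp ?t))) (Max (supp ?t))"
    by (simp add: nerve_strat_class)
  also have "\<dots> = st (Max (supp ?t))"
    using Mx I(1) snap_fix[OF I(1) Mx] by (auto simp: lab_code)
  finally show ?thesis using assms by (simp add: realize_def)
qed

end

section \<open>The ambient space and its subspaces\<close>

type_synonym ambient = "(nat \<Rightarrow> real) \<times> (nat \<Rightarrow> complex)"

text \<open>A point of the ambient space is a countable family of real numbers, and each real number
  amounts to a set of natural numbers.\<close>
lemma ambient_lepoll_real: "(UNIV :: ambient set) \<lesssim> (UNIV :: real set)"
proof -
  obtain r :: "real \<Rightarrow> nat set" where r: "inj r"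
    using eqpoll_imp_lepoll[OF eqpoll_sym[OF nat_sets_eqpoll_reals]] by (auto simp: lepoll_def)
  define c :: "ambient \<Rightarrow> nat \<Rightarrow> nat \<Rightarrow> real" where
    "c x i n = (if i = 0 then fst x n else if i = 1 then Re (snd x n) else Im (snd x n))" for x i n
  define g :: "ambient \<Rightarrow> nat set" where
    "g x = {k. case from_nat k of (i, n, m) \<Rightarrow> m \<in> r (c x i n)}" for x
  have "inj g"
  proof (rule injI)
    fix x y assume "g x = g y"
    then have "to_nat (i, n, m) \<in> g x \<longleftrightarrow> to_nat (i, n, m) \<in> g y" for i n m :: nat by simp
    then have "r (c x i n) = r (c y i n)" for i n
      by (auto simp: g_def)
    then have c: "c x i n = c y i n" for i n using injD[OF r] by blast
    have "fst x n = fst y n" "Re (snd x n) = Re (snd y n)" "Im (snd x n) = Im (snd y n)" for n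
      using c[of 0 n] c[of 1 n] c[of 2 n] by (simp_all add: c_def)
    then show "x = y" by (intro prod_eqI ext complex_eqI)
  qed
  then have "(UNIV :: ambient set) \<lesssim> (UNIV :: nat set set)"
    by (auto simp: lepoll_def)
  then show ?thesis
    using lepoll_trans eqpoll_imp_lepoll[OF nat_sets_eqpoll_reals] by blast
qed

definition ambient_topology :: "ambient topology" where
  "ambient_topology = prod_topology (powertop_real UNIV) (product_topology (\<lambda>_. euclidean) UNIV)"

lemma topspace_ambient_topology [simp]: "topspace ambient_topology = UNIV"
  by (simp add: ambient_topology_def)

lemma continuous_map_coordinate: "continuous_map ambient_topology euclideanreal (\<lambda>x. fst x i)"
  unfolding ambient_topology_def
  by (rule continuous_map_compose[OF continuous_map_fst, unfolded o_def])
     (rule continuous_map_product_projection, simp)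

lemma continuous_map_angle: "continuous_map ambient_topology euclidean (\<lambda>x. snd x k)"
  unfolding ambient_topology_def
  by (rule continuous_map_compose[OF continuous_map_snd, unfolded o_def])
     (rule continuous_map_product_projection, simp)

lemma continuous_map_into_ambient_topology:
  assumes "\<And>i. continuous_map T euclideanreal (\<lambda>x. fst (f x) i)"
    and "\<And>k. continuous_map T euclidean (\<lambda>x. snd (f x) k)"
  shows "continuous_map T ambient_topology f"
  unfolding ambient_topology_def continuous_map_componentwise_UNIV
  using assms by (simp add: continuous_map_pairwise o_def continuous_map_componentwise_UNIV)

definition height :: "ambient \<Rightarrow> real" where
  "height x = fst x 2 + fst x 3"

lemma continuous_map_height: "continuous_map ambient_topology euclideanreal height"
  unfolding height_def[abs_def] by (intro continuous_map_add continuous_map_coordinate)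

text \<open>Heights at which the \<open>k\<close>-th loop is attached: those \<open>h\<close> with \<open>\<bar>1 / h - (k + 2)\<bar> < 1 / 3\<close>. There the function
  \<open>cos (pi / h)\<close>, which will decide about the side on which the spiral runs, has absolute value above
  \<open>1 / 2\<close> and the sign of \<open>(-1)^k\<close>. The windows tend to \<open>0\<close> and lie in \<open>]0, 1[\<close>.\<close>
definition window :: "nat \<Rightarrow> real set" where
  "window k = {3 / (3 * real k + 7)<..<3 / (3 * real k + 5)}"

definition horn :: "(nat \<Rightarrow> real) set" where
  "horn = {t \<in> standard_simplex 3. t 0 = 0 \<or> t 2 = 0 \<or> t 3 = 0}"

text \<open>The space \<open>W\<close>. Because the loops are circle coordinates and not attached circles, the map to the
  \<open>k\<close>-th circle, whose winding number is to be measured, is a projection.\<close>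
definition looped_simplex :: "ambient set" where
  "looped_simplex = {(t, z). t \<in> standard_simplex 3 \<and>
     (\<forall>k. norm (z k) = 1 \<and> (z k \<noteq> 1 \<longrightarrow> height (t, z) \<in> window k))}"

text \<open>The space \<open>X\<close>. The last condition puts the even and the odd loops over the two edges that the horn
  does not connect near vertex \<open>0\<close>.\<close>
definition looped_horn :: "ambient set" where
  "looped_horn = {(t, z) \<in> looped_simplex. t \<in> horn \<and>
     (\<forall>k. z k \<noteq> 1 \<longrightarrow> t 1 = 0 \<and> t (if even k then 3 else 2) = 0)}"

definition flat :: "(nat \<Rightarrow> real) set \<Rightarrow> ambient set" where
  "flat S = S \<times> {\<lambda>_. 1}"

lemma height_nonneg: "x \<in> looped_simplex \<Longrightarrow> 0 \<le> height x"
  by (auto simp: looped_simplex_def height_def standard_simplex_def)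

lemma horn_subset: "horn \<subseteq> standard_simplex 3"
  by (auto simp: horn_def)

lemma flat_subset_looped_simplex: "S \<subseteq> standard_simplex 3 \<Longrightarrow> flat S \<subseteq> looped_simplex"
  by (auto simp: flat_def looped_simplex_def)

lemma flat_horn_subset: "flat horn \<subseteq> looped_horn"
  using flat_subset_looped_simplex[OF horn_subset] by (auto simp: flat_def looped_horn_def)

lemma looped_horn_subset: "looped_horn \<subseteq> looped_simplex"
  by (auto simp: looped_horn_def)

lemma homeomorphic_map_flat:
  "homeomorphic_map (subtopology (powertop_real UNIV) S) (subtopology ambient_topology (flat S)) (\<lambda>t. (t, \<lambda>_. 1))"
proof -
  have "continuous_map (subtopology (powertop_real UNIV) S) (subtopology ambient_topology (flat S)) (\<lambda>t. (t, \<lambda>_. 1))"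
    by (auto simp: continuous_map_in_subtopology flat_def
        intro!: continuous_map_into_ambient_topology continuous_map_from_subtopology continuous_map_product_projection)
  moreover have "continuous_map (subtopology ambient_topology (flat S)) (subtopology (powertop_real UNIV) S) fst"
    by (auto simp: continuous_map_in_subtopology flat_def continuous_map_componentwise_UNIV
        intro!: continuous_map_from_subtopology continuous_map_coordinate)
  ultimately have "homeomorphic_maps (subtopology (powertop_real UNIV) S) (subtopology ambient_topology (flat S))
      (\<lambda>t. (t, \<lambda>_. 1)) fst"
    by (auto simp: homeomorphic_maps_def flat_def)
  then show ?thesis using homeomorphic_map_maps by blast
qed

text \<open>An injection into the universe makes small stratified spaces out of the subsets of the ambient space.\<close>
locale encoding =
  fixes e :: "ambient \<Rightarrow> 'u" and p q :: "'p::order"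
  assumes inj_e: "inj e" and less: "p < q" and small: "range e \<prec> (UNIV :: 'u set)"
begin

definition level :: "ambient \<Rightarrow> 'p" where
  "level x = (if height x = 0 then p else q)"

definition space_of :: "ambient set \<Rightarrow> ('u, 'p) strat_space" where
  "space_of S = (push_top e (delta_ification (subtopology ambient_topology S)),
     restrict (level \<circ> inv_into UNIV e) (e ` S))"

definition incl :: "ambient set \<Rightarrow> ambient set \<Rightarrow> (('u, 'p) strat_space, 'u \<Rightarrow> 'u) arrow" where
  "incl S T = Arrow (space_of S) (space_of T) (restrict id (e ` S))"

lemma topspace_space_of [simp]: "topspace (fst (space_of S)) = e ` S"
  by (simp add: space_of_def topspace_push_top[OF inj_e])

lemma snd_space_of: "x \<in> S \<Longrightarrow> snd (space_of S) (e x) = level x"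
  by (simp add: space_of_def inj_e)

lemma continuous_map_into_space_of:
  assumes "delta_generated T" "continuous_map T ambient_topology f" "f \<in> topspace T \<rightarrow> S"
  shows "continuous_map T (fst (space_of S)) (e \<circ> f)"
proof -
  have "continuous_map T (subtopology ambient_topology S) f"
    using assms by (auto simp: continuous_map_in_subtopology)
  then have "continuous_map T (delta_ification (subtopology ambient_topology S)) f"
    by (rule continuous_map_into_delta_ification[OF assms(1)])
  then show ?thesis
    unfolding space_of_def fst_conv
    by (rule continuous_map_compose[OF _ continuous_map_push_top[OF inj_e]])
qed

lemma continuous_map_decode:
  "continuous_map (fst (space_of S)) (subtopology ambient_topology S) (inv_into UNIV e)"
  unfolding space_of_def fst_conv
  using continuous_map_compose[OF continuous_map_push_top_inv[OF inj_e]
      continuous_map_from_delta_ification[OF continuous_map_id]] by (simp add: id_comp)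

lemma delta_generated_space_of: "delta_generated (fst (space_of S))"
proof -
  have "homeomorphic_map (delta_ification (subtopology ambient_topology S)) (fst (space_of S)) e"
    using homeomorphic_maps_push_top[OF inj_e] homeomorphic_map_maps
    unfolding space_of_def by fastforce
  then show ?thesis
    by (rule delta_generated_homeomorphic_map[OF delta_generated_delta_ification])
qed

lemma continuous_map_level: "continuous_map (subtopology ambient_topology S) poset_topology level"
  unfolding continuous_map_def
proof (intro conjI allI impI)
  fix U :: "'p set" assume U: "openin poset_topology U"
  have 1: "openin (subtopology ambient_topology S) {x \<in> topspace (subtopology ambient_topology S). height x \<in> - {0}}"
    by (rule openin_continuous_map_preimage[OF continuous_map_from_subtopology[OF continuous_map_height]])
       (simp add: open_openin[symmetric] open_Compl)
  show "openin (subtopology ambient_topology S) {x \<in> topspace (subtopology ambient_topology S). level x \<in> U}"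
  proof (cases "p \<in> U")
    case True
    then have "q \<in> U" using U less unfolding openin_poset_topology by (meson less_imp_le)
    with True have "level x \<in> U" for x by (simp add: level_def)
    then show ?thesis using openin_topspace[of "subtopology ambient_topology S"] by simp
  next
    case p: False
    show ?thesis
    proof (cases "q \<in> U")
      case True
      with p have "{x \<in> topspace (subtopology ambient_topology S). level x \<in> U} =
          {x \<in> topspace (subtopology ambient_topology S). height x \<in> - {0}}"
        by (auto simp: level_def)
      then show ?thesis using 1 by simp
    next
      case False
      with p have "level x \<notin> U" for x by (simp add: level_def)
      then show ?thesis by simp
    qed
  qed
qed auto

lemma space_of_in_Top_P: "space_of S \<in> Obj Top_P"
proof -
  have "continuous_map (fst (space_of S)) poset_topology (snd (space_of S))"
    by (rule continuous_map_eq[OF continuous_map_compose[OF continuous_map_decode continuous_map_level]])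
       (auto simp: space_of_def topspace_push_top inj_e)
  then have "stratified_space (space_of S)"
    by (simp add: stratified_space_def delta_generated_space_of) (simp add: space_of_def)
  moreover have "e ` S \<prec> (UNIV :: 'u set)"
    using small subset_imp_lepoll[of "e ` S" "range e"] by (meson image_mono lesspoll_trans1 subset_UNIV)
  ultimately show ?thesis by (simp add: Top_P_def)
qed

lemma incl_hom:
  assumes "S \<subseteq> T"
  shows "incl S T \<in> cat_hom Top_P (space_of S) (space_of T)"
proof -
  have "continuous_map (fst (space_of S)) (fst (space_of T)) (e \<circ> inv_into UNIV e)"
    using continuous_map_decode[of S] assms inj_e
    by (intro continuous_map_into_space_of[OF delta_generated_space_of])
       (auto simp: continuous_map_in_subtopology)
  then have "continuous_map (fst (space_of S)) (fst (space_of T)) (restrict id (e ` S))"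
    by (rule continuous_map_eq) (auto simp: inj_e)
  moreover have "snd (space_of T) (restrict id (e ` S) x) = snd (space_of S) x"
    if x: "x \<in> e ` S" for x
  proof -
    from x obtain y where "x = e y" "y \<in> S" by blast
    then show ?thesis using subsetD[OF assms] by (simp add: snd_space_of)
  qed
  ultimately have "strat_map (space_of S) (space_of T) (restrict id (e ` S))"
    by (simp add: strat_map_def)
  then show ?thesis
    using space_of_in_Top_P by (auto simp: cat_hom_Top_P incl_def)
qed

end


section \<open>The horn inclusion as a realization\<close>

definition horn_faces :: "nat set set" where
  "horn_faces = {I. \<not> {0, 2, 3} \<subseteq> I}"

lemma faces_space_horn: "faces_space 3 horn_faces = horn"
  by (auto simp: faces_space_def horn_faces_def horn_def)

lemma faces_space_UNIV: "faces_space 3 UNIV = standard_simplex 3"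
  by (simp add: faces_space_def)

lemma Max_supp_simplex3:
  assumes "t \<in> standard_simplex 3"
  shows "Max (supp t) \<le> 1 \<longleftrightarrow> t 2 + t 3 = 0"
proof -
  have t0: "t i \<ge> 0" for i using assms by (auto simp: standard_simplex_def)
  have fin: "finite (supp t)" using supp_subset[OF assms] finite_subset by blast
  have "Max (supp t) \<le> 1 \<longleftrightarrow> (\<forall>i. t i \<noteq> 0 \<longrightarrow> i \<le> 1)"
    using Max_le_iff[OF fin supp_nonempty[OF assms]] by simp
  also have "\<dots> \<longleftrightarrow> t 2 = 0 \<and> t 3 = 0"
  proof
    assume "\<forall>i. t i \<noteq> 0 \<longrightarrow> i \<le> 1"
    then show "t 2 = 0 \<and> t 3 = 0" by force
  next
    assume z: "t 2 = 0 \<and> t 3 = 0"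
    show "\<forall>i. t i \<noteq> 0 \<longrightarrow> i \<le> 1"
    proof (intro allI impI)
      fix i assume i: "t i \<noteq> 0"
      then have "i \<noteq> 2" "i \<noteq> 3" using z by auto
      with supp_le[OF assms i] show "i \<le> 1" by linarith
    qed
  qed
  also have "\<dots> \<longleftrightarrow> t 2 + t 3 = 0" using t0[of 2] t0[of 3] by auto
  finally show ?thesis .
qed

context encoding begin

definition code :: "(nat \<Rightarrow> nat) \<Rightarrow> 'u" where
  "code \<sigma> = e (\<lambda>i. real (\<sigma> i), \<lambda>_. 0)"

definition vertex_level :: "nat \<Rightarrow> 'p" where
  "vertex_level i = (if i \<le> 1 then p else q)"

lemma simplex_faces_vertex_level:
  assumes "\<And>I J. \<lbrakk>I \<in> D; J \<subseteq> I; J \<noteq> {}\<rbrakk> \<Longrightarrow> J \<in> D"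
  shows "simplex_faces code 3 D vertex_level"
proof
  show "inj code"
    using injD[OF inj_e] by (fastforce simp: inj_def code_def fun_eq_iff)
  show "mono_on {..3} vertex_level"
    using less by (auto simp: mono_on_def vertex_level_def)
qed (rule assms)

sublocale A: simplex_faces code 3 horn_faces vertex_level
  by (rule simplex_faces_vertex_level) (auto simp: horn_faces_def)

sublocale B: simplex_faces code 3 UNIV vertex_level
  by (rule simplex_faces_vertex_level) auto

definition sset_of :: "nat set set \<Rightarrow> ('u, 'p) strat_sset" where
  "sset_of D = (faces_sset code 3 D, faces_label code vertex_level)"

definition horn_incl :: "(('u, 'p) strat_sset, nat \<Rightarrow> 'u \<Rightarrow> 'u) arrow" where
  "horn_incl = Arrow (sset_of horn_faces) (sset_of UNIV)
     (\<lambda>n. restrict id (simps (faces_sset code 3 horn_faces) n))"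

lemma small_faces: "small_sset (faces_sset code 3 D)"
proof -
  have "(\<Union>n. simps (faces_sset code 3 D) n) \<subseteq> range e"
    by (auto simp: faces_sset_def code_def)
  then show ?thesis
    unfolding small_sset_def using small by (meson lesspoll_trans1 subset_imp_lepoll)
qed

lemma horn_simps_subset:
  "simps (faces_sset code 3 horn_faces) n \<subseteq> simps (faces_sset code 3 UNIV) n"
  by (auto simp: faces_sset_def)

lemma simplicial_map_horn_incl:
  "simplicial_map (faces_sset code 3 horn_faces) (faces_sset code 3 UNIV)
     (\<lambda>n. restrict id (simps (faces_sset code 3 horn_faces) n))"
proof -
  have "act (faces_sset code 3 horn_faces) m n \<alpha> x \<in> simps (faces_sset code 3 horn_faces) m"
    if "\<alpha> \<in> Delta_maps m n" "x \<in> simps (faces_sset code 3 horn_faces) n" for m n \<alpha> x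
    using A.simplicial_set_faces that unfolding simplicial_set_def by blast
  moreover have "act (faces_sset code 3 horn_faces) = act (faces_sset code 3 UNIV)"
    by (simp add: faces_sset_def)
  ultimately show ?thesis
    using subsetD[OF horn_simps_subset] by (auto simp: simplicial_map_def)
qed

lemma horn_incl_Arr: "horn_incl \<in> Arr sSet_P"
  using A.stratified_sset_faces B.stratified_sset_faces small_faces simplicial_map_horn_incl
  by (auto simp: sSet_P_def horn_incl_def sset_of_def)

lemma monomorphism_horn_incl: "monomorphism sSet_P horn_incl"
  unfolding monomorphism_def
proof (intro conjI allI ballI impI)
  show "horn_incl \<in> Arr sSet_P" by (rule horn_incl_Arr)
  fix Z g h
  assume g: "g \<in> cat_hom sSet_P Z (Dom sSet_P horn_incl)"
    and h: "h \<in> cat_hom sSet_P Z (Dom sSet_P horn_incl)"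
    and eq: "Comp sSet_P horn_incl g = Comp sSet_P horn_incl h"
  have D: "Dom sSet_P horn_incl = sset_of horn_faces"
    by (simp add: sSet_P_def horn_incl_def)
  obtain a where a: "g = Arrow Z (sset_of horn_faces) a"
    "simplicial_map (fst Z) (fst (sset_of horn_faces)) a" "\<forall>n. a n \<in> extensional (simps (fst Z) n)"
    using g unfolding D cat_hom_sSet_P by blast
  obtain b where b: "h = Arrow Z (sset_of horn_faces) b"
    "simplicial_map (fst Z) (fst (sset_of horn_faces)) b" "\<forall>n. b n \<in> extensional (simps (fst Z) n)"
    using h unfolding D cat_hom_sSet_P by blast
  have "compose (simps (fst Z) n) (fn horn_incl n) c = c"
    if "c \<in> simps (fst Z) n \<rightarrow> simps (fst (sset_of horn_faces)) n" "c \<in> extensional (simps (fst Z) n)" for c n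
    using that by (auto simp: fun_eq_iff compose_def horn_incl_def sset_of_def extensional_def Pi_iff)
  moreover have "compose (simps (fst Z) n) (fn horn_incl n) (a n) =
      compose (simps (fst Z) n) (fn horn_incl n) (b n)" for n
    using eq by (simp add: sSet_P_def a(1) b(1) fun_eq_iff)
  ultimately have "a n = b n" for n
    using a(2,3) b(2,3) unfolding simplicial_map_def by metis
  then show "g = h" by (simp add: a(1) b(1) fun_eq_iff)
qed

lemma strat_homeomorphism_faces:
  assumes D: "simplex_faces code 3 D vertex_level"
  shows "strat_homeomorphism (realize (sset_of D)) (space_of (flat (faces_space 3 D)))
    (\<lambda>\<xi>. e (simplex_faces.class_position code \<xi>, \<lambda>_. 1))"
    and "delta_generated (subtopology ambient_topology (flat (faces_space 3 D)))"
proof -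
  interpret simplex_faces code 3 D vertex_level by (rule D)
  let ?F = "faces_space 3 D"
  let ?h = "\<lambda>\<xi>. (class_position \<xi>, \<lambda>_ :: nat. 1 :: complex)"
  have h: "homeomorphic_map (realization K) (subtopology ambient_topology (flat ?F)) ?h"
    using homeomorphic_map_compose[OF homeomorphic_class_position homeomorphic_map_flat]
    by (simp add: o_def)
  then show dg: "delta_generated (subtopology ambient_topology (flat ?F))"
    by (rule delta_generated_homeomorphic_map[OF delta_generated_realization])
  have "homeomorphic_map (subtopology ambient_topology (flat ?F)) (fst (space_of (flat ?F))) e"
    using homeomorphic_maps_push_top[OF inj_e] homeomorphic_map_maps dg
    unfolding space_of_def delta_generated_def by fastforce
  from homeomorphic_map_compose[OF h this]
  have hm: "homeomorphic_map (fst (realize (sset_of D))) (fst (space_of (flat ?F))) (\<lambda>\<xi>. e (?h \<xi>))"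
    by (simp add: o_def sset_of_def realize_def)
  have "snd (space_of (flat ?F)) (e (?h \<xi>)) = snd (realize (sset_of D)) \<xi>"
    if \<xi>: "\<xi> \<in> topspace (fst (realize (sset_of D)))" for \<xi>
  proof -
    have \<xi>': "\<xi> \<in> topspace (realization K)" using \<xi> by (simp add: sset_of_def realize_def)
    have F: "class_position \<xi> \<in> ?F" by (rule class_standard_cell(1)[OF \<xi>'])
    have "snd (realize (sset_of D)) \<xi> = vertex_level (Max (supp (class_position \<xi>)))"
      unfolding sset_of_def by (rule realize_stratum[OF \<xi>'])
    also have "\<dots> = level (?h \<xi>)"
      using F Max_supp_simplex3[of "class_position \<xi>"]
      by (simp add: vertex_level_def level_def height_def faces_space_def)
    finally show ?thesis using F by (simp add: snd_space_of flat_def)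
  qed
  then show "strat_homeomorphism (realize (sset_of D)) (space_of (flat ?F)) (\<lambda>\<xi>. e (?h \<xi>))"
    using hm homeomorphic_imp_continuous_map unfolding strat_homeomorphism_def strat_map_def by blast
qed

lemma is_realization_of_horn_incl:
  "is_realization_of (incl (flat horn) (flat (standard_simplex 3))) horn_incl"
  unfolding is_realization_of_def
proof (intro exI conjI ballI)
  let ?h = "\<lambda>\<xi>. e (A.class_position \<xi>, \<lambda>_. 1)"
  show "strat_homeomorphism (realize (src horn_incl)) (src (incl (flat horn) (flat (standard_simplex 3)))) ?h"
    using strat_homeomorphism_faces(1)[OF A.simplex_faces_axioms]
    by (simp add: horn_incl_def incl_def faces_space_horn)
  show "strat_homeomorphism (realize (tgt horn_incl)) (tgt (incl (flat horn) (flat (standard_simplex 3)))) ?h"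
    using strat_homeomorphism_faces(1)[OF B.simplex_faces_axioms]
    by (simp add: horn_incl_def incl_def faces_space_UNIV)
  fix \<xi> assume "\<xi> \<in> topspace (fst (realize (src horn_incl)))"
  then have \<xi>: "\<xi> \<in> topspace (realization (faces_sset code 3 horn_faces))"
    by (simp add: horn_incl_def sset_of_def realize_def)
  obtain n x t where x: "x \<in> simps (faces_sset code 3 horn_faces) n" "t \<in> standard_simplex n"
    and \<xi>x: "\<xi> = gluing_equiv (faces_sset code 3 horn_faces) `` {(n, x, t)}"
    using realization_cases[OF \<xi>] .
  have cA: "(n, x, t) \<in> cell_points (faces_sset code 3 horn_faces)"
    and cB: "(n, x, t) \<in> cell_points (faces_sset code 3 UNIV)"
    using x horn_simps_subset by (auto simp: cell_points_def)
  have "realization_map (fst (tgt horn_incl)) (fn horn_incl) \<xi> =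
      gluing_equiv (faces_sset code 3 UNIV) `` {(n, x, t)}"
    using realization_map_class[OF simplicial_map_horn_incl cA] x(1)
    by (simp add: horn_incl_def sset_of_def \<xi>x)
  then have "A.class_position (realization_map (fst (tgt horn_incl)) (fn horn_incl) \<xi>) = A.class_position \<xi>"
    using A.class_position[OF cA] B.class_position[OF cB] by (simp add: \<xi>x)
  moreover have "(A.class_position \<xi>, \<lambda>_. 1) \<in> flat horn"
    using A.class_standard_cell(1)[OF \<xi>] by (simp add: flat_def faces_space_horn)
  ultimately show "?h (realization_map (fst (tgt horn_incl)) (fn horn_incl) \<xi>) =
      fn (incl (flat horn) (flat (standard_simplex 3))) (?h \<xi>)"
    by (simp add: incl_def)
qed

end

section \<open>The horn inclusion as a stratified homotopy equivalence\<close>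

definition slide :: "real \<Rightarrow> ambient \<Rightarrow> ambient" where
  "slide s x = ((\<lambda>i. if i = 0 then (1 - s) * fst x 0 else if i = 1 then fst x 1 + s * fst x 0
     else fst x i), snd x)"

lemma slide_0: "slide 0 x = x"
  by (auto simp: slide_def prod_eq_iff fun_eq_iff)

lemma height_slide: "height (slide s x) = height x"
  by (simp add: height_def slide_def)

lemma slide_simplex:
  assumes "0 \<le> s" "s \<le> 1" "x \<in> flat (standard_simplex 3)"
  shows "slide s x \<in> flat (standard_simplex 3)"
proof -
  obtain t where x: "x = (t, \<lambda>_. 1)" and t: "t \<in> standard_simplex 3"
    using assms(3) by (auto simp: flat_def)
  have t0: "0 \<le> t i" for i using t by (auto simp: standard_simplex_def)
  let ?t = "fst (slide s x)"
  have 3: "{..3} = {0, 1, 2, 3 :: nat}" by auto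
  have "0 \<le> ?t i" for i using t0 assms by (simp add: slide_def x)
  moreover have "?t i = 0" if "i > 3" for i using t that by (simp add: slide_def x standard_simplex_def)
  moreover have 1: "(\<Sum>i\<le>3. ?t i) = 1"
    using t by (simp add: slide_def x standard_simplex_def 3 algebra_simps)
  ultimately have "?t i \<le> 1" for i
  proof (cases "i \<le> 3")
    case True
    then have "?t i \<le> (\<Sum>i\<le>3. ?t i)" using \<open>\<And>i. 0 \<le> ?t i\<close> by (intro member_le_sum) auto
    then show ?thesis using 1 by simp
  next
    case False
    then show ?thesis using \<open>\<And>i. i > 3 \<Longrightarrow> ?t i = 0\<close> by simp
  qed
  then have "?t \<in> standard_simplex 3"
    unfolding standard_simplex_def
    using \<open>\<And>i. 0 \<le> ?t i\<close> \<open>\<And>i. i > 3 \<Longrightarrow> ?t i = 0\<close> 1 by blast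
  then show ?thesis by (auto simp: flat_def slide_def x)
qed

lemma slide_horn:
  assumes "0 \<le> s" "s \<le> 1" "x \<in> flat horn"
  shows "slide s x \<in> flat horn"
  using slide_simplex[OF assms(1,2), of x] assms(3) by (auto simp: flat_def horn_def slide_def)

lemma slide_1_horn:
  assumes "x \<in> flat (standard_simplex 3)"
  shows "slide 1 x \<in> flat horn"
  using slide_simplex[of 1, OF _ _ assms] by (auto simp: flat_def horn_def slide_def)

lemma continuous_map_slide:
  "continuous_map (prod_topology (top_of_set {0..1}) ambient_topology) ambient_topology (\<lambda>y. slide (fst y) (snd y))"
proof (rule continuous_map_into_ambient_topology)
  let ?T = "prod_topology (top_of_set {0..1::real}) ambient_topology"
  have s: "continuous_map ?T euclideanreal fst"
    using continuous_map_fst[of "top_of_set {0..1::real}" ambient_topology] continuous_map_into_fulltopology by blast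
  have c: "continuous_map ?T euclideanreal (\<lambda>y. fst (snd y) i)" for i
    using continuous_map_compose[OF continuous_map_snd continuous_map_coordinate] by (simp add: o_def)
  fix i
  show "continuous_map ?T euclideanreal (\<lambda>y. fst (slide (fst y) (snd y)) i)"
    by (cases "i = 0"; cases "i = 1")
       (simp_all add: slide_def continuous_map_real_mult continuous_map_add continuous_map_diff s c)
next
  fix k
  show "continuous_map (prod_topology (top_of_set {0..1}) ambient_topology) euclidean (\<lambda>y. snd (slide (fst y) (snd y)) k)"
    using continuous_map_compose[OF continuous_map_snd continuous_map_angle]
    by (simp add: o_def slide_def)
qed

context encoding begin

lemma strat_homotopic_slide:
  assumes cl: "\<And>s x. \<lbrakk>0 \<le> s; s \<le> 1; x \<in> S\<rbrakk> \<Longrightarrow> slide s x \<in> S"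
    and dg: "delta_generated (subtopology ambient_topology S)"
  shows "strat_homotopic (space_of S) (space_of S) (e \<circ> slide 1 \<circ> inv_into UNIV e) id"
proof -
  let ?Y = "fst (space_of S)" and ?I = "top_of_set {0..1::real}"
  let ?P = "\<lambda>h. \<forall>x \<in> topspace ?Y. snd (space_of S) (h x) = snd (space_of S) x"
  define H where "H y = e (slide (fst y) (inv_into UNIV e (snd y)))" for y
  have inc: "continuous_map (subtopology ambient_topology S) ambient_topology id"
    by (simp add: continuous_map_from_subtopology)
  have dec: "continuous_map (prod_topology ?I ?Y) ambient_topology (inv_into UNIV e \<circ> snd)"
    using continuous_map_compose[OF continuous_map_compose[OF continuous_map_snd continuous_map_decode] inc]
    by simp
  have "continuous_map (prod_topology ?I ?Y) (prod_topology ?I ambient_topology) (\<lambda>y. (fst y, inv_into UNIV e (snd y)))"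
    using dec continuous_map_fst by (intro continuous_map_pairedI) (auto simp: o_def)
  from continuous_map_compose[OF this continuous_map_slide]
  have "continuous_map (prod_topology ?I ?Y) ambient_topology (\<lambda>y. slide (fst y) (inv_into UNIV e (snd y)))"
    by (simp add: o_def)
  then have "continuous_map (prod_topology ?I ?Y) (subtopology ambient_topology S) (\<lambda>y. slide (fst y) (inv_into UNIV e (snd y)))"
    using cl inj_e by (auto simp: continuous_map_in_subtopology)
  from continuous_map_compose[OF this continuous_map_push_top[OF inj_e]]
  have "continuous_map (prod_topology ?I ?Y) (push_top e (subtopology ambient_topology S)) H"
    by (simp add: H_def[abs_def] o_def)
  moreover have "push_top e (subtopology ambient_topology S) = ?Y"
    using dg by (simp add: space_of_def delta_generated_def)
  ultimately have "continuous_map (prod_topology ?I ?Y) ?Y H" by simp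
  moreover have "?P (\<lambda>x. H (s, x))" if "s \<in> {0..1}" for s
    using that cl by (auto simp: H_def inj_e snd_space_of level_def height_slide)
  ultimately have "homotopic_with ?P ?Y ?Y (\<lambda>x. H (0, x)) (\<lambda>x. H (1, x))"
    unfolding homotopic_with_def by (intro exI[of _ H]) auto
  then have "homotopic_with ?P ?Y ?Y (\<lambda>x. H (1, x)) (\<lambda>x. H (0, x))"
    by (rule homotopic_with_symD)
  then show ?thesis
    unfolding strat_homotopic_def
    by (rule homotopic_with_eq) (auto simp: H_def slide_0 inj_e)
qed

text \<open>The end \<open>slide 1\<close> of the deformation is a homotopy inverse of the inclusion: the deformation
  itself is the homotopy on the tetrahedron and, by \<open>slide_horn\<close>, also on the horn.\<close>
lemma strat_homotopy_equivalence_horn: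
  "strat_homotopy_equivalence (space_of (flat horn)) (space_of (flat (standard_simplex 3)))
     (restrict id (e ` flat horn))"
  unfolding strat_homotopy_equivalence_def
proof (intro conjI exI)
  let ?A = "flat horn" and ?B = "flat (standard_simplex 3)"
  let ?r = "e \<circ> slide 1 \<circ> inv_into UNIV e"
  have AB: "?A \<subseteq> ?B" using horn_subset by (auto simp: flat_def)
  have dA: "delta_generated (subtopology ambient_topology ?A)"
    using strat_homeomorphism_faces(2)[OF A.simplex_faces_axioms] by (simp add: faces_space_horn)
  have dB: "delta_generated (subtopology ambient_topology ?B)"
    using strat_homeomorphism_faces(2)[OF B.simplex_faces_axioms] by (simp add: faces_space_UNIV)
  show "strat_map (space_of ?A) (space_of ?B) (restrict id (e ` ?A))"
    using incl_hom[OF AB] by (auto simp: cat_hom_Top_P incl_def)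
  have "continuous_map ambient_topology ambient_topology (slide 1)"
    using continuous_map_compose[OF continuous_map_pairedI[of ambient_topology _ "\<lambda>_. 1" _ id] continuous_map_slide]
    by (simp add: o_def)
  then have "continuous_map (fst (space_of ?B)) ambient_topology (slide 1 \<circ> inv_into UNIV e)"
    by (rule continuous_map_compose[OF continuous_map_into_fulltopology[OF continuous_map_decode]])
  then have "continuous_map (fst (space_of ?B)) (fst (space_of ?A)) (e \<circ> (slide 1 \<circ> inv_into UNIV e))"
    by (rule continuous_map_into_space_of[OF delta_generated_space_of])
       (auto simp: inj_e intro!: slide_1_horn)
  then have "continuous_map (fst (space_of ?B)) (fst (space_of ?A)) ?r"
    by (simp add: o_assoc)
  moreover have "snd (space_of ?A) (?r y) = snd (space_of ?B) y" if "y \<in> topspace (fst (space_of ?B))" for y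
    using that slide_1_horn by (auto simp: inj_e snd_space_of level_def height_slide)
  ultimately show "strat_map (space_of ?B) (space_of ?A) ?r"
    by (simp add: strat_map_def)
  have hA: "strat_homotopic (space_of ?A) (space_of ?A) ?r id"
    by (rule strat_homotopic_slide[OF slide_horn dA])
  have hB: "strat_homotopic (space_of ?B) (space_of ?B) ?r id"
    by (rule strat_homotopic_slide[OF slide_simplex dB])
  show "strat_homotopic (space_of ?A) (space_of ?A) (?r \<circ> restrict id (e ` ?A)) id"
    using hA unfolding strat_homotopic_def by (rule homotopic_with_eq) auto
  show "strat_homotopic (space_of ?B) (space_of ?B) (restrict id (e ` ?A) \<circ> ?r) id"
    using hB unfolding strat_homotopic_def
    by (rule homotopic_with_eq) (auto simp: inj_e slide_1_horn)
qed

end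


section \<open>Paths in mapping spaces\<close>

lemma topspace_compact_open:
  "topspace (compact_open X Y) = {f. continuous_map X Y f \<and> f \<in> extensional (topspace X)}"
proof -
  have "compactin X {}" "openin Y {}" by simp_all
  then show ?thesis
    unfolding compact_open_def topology_generated_by_topspace by auto
qed

lemma openin_compact_open_basic:
  assumes "compactin X C" "openin Y U"
  shows "openin (compact_open X Y)
    {f. continuous_map X Y f \<and> f \<in> extensional (topspace X) \<and> f ` C \<subseteq> U}"
  unfolding compact_open_def by (rule topology_generated_by_Basis) (use assms in blast)

text \<open>Since the interval is locally compact, a point has a compact neighbourhood on which a path stays in a
  given open set, and this is an open condition on the path.\<close>
lemma continuous_map_uncurry:
  assumes P: "continuous_map T (compact_open (top_of_set {0..1::real}) Y) P"
  shows "continuous_map (prod_topology T (top_of_set {0..1})) Y (\<lambda>y. P (fst y) (snd y))"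
proof -
  let ?I = "top_of_set {0..1::real}"
  have Pu: "continuous_map ?I Y (P u)" if "u \<in> topspace T" for u
    using continuous_map_funspace[OF P] that by (auto simp: topspace_compact_open)
  have "\<exists>N. openin (prod_topology T ?I) N \<and> y \<in> N \<and> N \<subseteq> {y \<in> topspace (prod_topology T ?I). P (fst y) (snd y) \<in> U}"
    if U: "openin Y U" and y: "y \<in> topspace (prod_topology T ?I)" "P (fst y) (snd y) \<in> U" for U y
  proof -
    obtain u0 t0 where y0: "y = (u0, t0)" and u0: "u0 \<in> topspace T" and t0: "t0 \<in> {0..1}"
      using y(1) by (cases y) auto
    have "openin ?I {t \<in> topspace ?I. P u0 t \<in> U}"
      by (rule openin_continuous_map_preimage[OF Pu[OF u0] U])
    then obtain d where d: "d > 0" "\<And>t. \<lbrakk>t \<in> {0..1}; dist t t0 < d\<rbrakk> \<Longrightarrow> P u0 t \<in> U"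
      unfolding openin_euclidean_subtopology_iff using t0 y(2) by (auto simp: y0)
    \<comment> \<open>Half the radius, for a compact neighbourhood inside the open ball.\<close>
  define C where "C = cball t0 (d/2) \<inter> {0..1}"
    have C: "compactin ?I C"
      by (auto simp: C_def compactin_subtopology intro: compact_Int_closed)
    have dC: "P u0 t \<in> U" if "t \<in> C" for t
      using d that by (auto simp: C_def dist_commute)
    define V where "V = {f. continuous_map ?I Y f \<and> f \<in> extensional (topspace ?I) \<and> f ` C \<subseteq> U}"
    have "openin T {u \<in> topspace T. P u \<in> V}"
      unfolding V_def by (rule openin_continuous_map_preimage[OF P openin_compact_open_basic[OF C U]])
    moreover have "openin ?I (ball t0 (d/2) \<inter> {0..1})"
      by (simp add: openin_open_Int Int_commute)
    ultimately have "openin (prod_topology T ?I) ({u \<in> topspace T. P u \<in> V} \<times> (ball t0 (d/2) \<inter> {0..1}))"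
      by (simp add: openin_prod_Times_iff)
    moreover have "P u0 \<in> V"
      using continuous_map_funspace[OF P] u0 dC by (auto simp: V_def topspace_compact_open)
    moreover have "P u t \<in> U" if "P u \<in> V" "t \<in> ball t0 (d/2) \<inter> {0..1}" for u t
      using that by (auto simp: V_def C_def image_subset_iff)
    ultimately show ?thesis
      using u0 t0 d(1) y0
      by (intro exI[of _ "{u \<in> topspace T. P u \<in> V} \<times> (ball t0 (d/2) \<inter> {0..1})"]) auto
  qed
  moreover have "P (fst y) (snd y) \<in> topspace Y" if "y \<in> topspace (prod_topology T ?I)" for y
    using continuous_map_funspace[OF Pu, of "fst y"] that by (auto simp: Pi_iff)
  ultimately show ?thesis
    unfolding continuous_map_def by (subst (2) openin_subopen) auto
qed


section \<open>Winding numbers\<close>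

lemma exp_eq_1_endpoints:
  fixes h :: "real \<Rightarrow> complex"
  assumes h: "continuous_on {0..1} h" and e: "\<And>t. t \<in> {0..1} \<Longrightarrow> exp (h t) = 1"
  shows "h 0 = h 1"
proof -
  have "h constant_on {0..1}"
  proof (rule continuous_discrete_range_constant[OF _ h])
    fix x :: real assume x: "x \<in> {0..1}"
    have "1 \<le> norm (h y - h x)" if y: "y \<in> {0..1} \<and> h y \<noteq> h x" for y
    proof -
      have "exp (h y) = exp (h x)" using e x y by simp
      then obtain n :: int where n: "h y = h x + (of_int (2 * n) * pi) * \<i>"
        using exp_eq by blast
      with y have "n \<noteq> 0" by auto
      then have "1 \<le> \<bar>real_of_int n\<bar>" by linarith
      moreover have "norm (h y - h x) = 2 * \<bar>real_of_int n\<bar> * pi"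
        by (simp add: n norm_mult)
      ultimately show ?thesis
        using pi_ge_two mult_mono[of 1 "2 * \<bar>real_of_int n\<bar>" 1 pi] by linarith
    qed
    then show "\<exists>e>0. \<forall>y. y \<in> {0..1} \<and> h y \<noteq> h x \<longrightarrow> e \<le> norm (h y - h x)"
      by (intro exI[of _ 1]) auto
  qed simp
  then show ?thesis unfolding constant_on_def by force
qed

text \<open>A logarithm of \<open>f\<close> on the square is constant along the sides on which \<open>f\<close> is \<open>1\<close>, so its increment along the
  remaining side is \<open>0\<close>, whereas the formula for \<open>f\<close> there makes it \<open>2 * pi * \<i>\<close>.\<close>
lemma no_unwinding:
  fixes f :: "real \<times> real \<Rightarrow> complex" and w :: "real \<Rightarrow> real"
  assumes f: "continuous_on ({0..1} \<times> {0..1}) f" "\<And>y. y \<in> {0..1} \<times> {0..1} \<Longrightarrow> f y \<noteq> 0"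
    and sides: "\<And>u. u \<in> {0..1} \<Longrightarrow> f (u, 0) = 1" "\<And>u. u \<in> {0..1} \<Longrightarrow> f (u, 1) = 1"
    and left: "\<And>t. t \<in> {0..1} \<Longrightarrow> f (0, t) = 1"
    and right: "\<And>t. t \<in> {0..1} \<Longrightarrow> f (1, t) = exp (2 * pi * \<i> * w t)"
    and w: "continuous_on {0..1} w" "w 0 = 0" "w 1 = 1"
  shows False
proof -
  have "contractible ({0..1::real} \<times> {0..1::real})"
    by (intro convex_imp_contractible convex_Times) auto
  then obtain g where g: "continuous_on ({0..1} \<times> {0..1}) g"
    and fg: "\<And>y. y \<in> {0..1} \<times> {0..1} \<Longrightarrow> f y = exp (g y)"
    using continuous_logarithm_on_contractible[OF f(1) _ f(2)] by blast
  have cont: "continuous_on {0..1} (\<lambda>s. g (a s))"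
    if "continuous_on {0..1} a" "a \<in> {0..1} \<rightarrow> {0..1} \<times> {0..1}" for a :: "real \<Rightarrow> _"
    using that by (intro continuous_on_compose2[OF g]; blast)
  have "g (0, 0) = g (1, 0)"
    by (rule exp_eq_1_endpoints[where h = "\<lambda>u. g (u, 0)"])
       (auto intro!: cont continuous_intros simp: fg[symmetric] sides)
  moreover have "g (0, 1) = g (1, 1)"
    by (rule exp_eq_1_endpoints[where h = "\<lambda>u. g (u, 1)"])
       (auto intro!: cont continuous_intros simp: fg[symmetric] sides)
  moreover have "g (0, 0) = g (0, 1)"
    by (rule exp_eq_1_endpoints[where h = "\<lambda>t. g (0, t)"])
       (auto intro!: cont continuous_intros simp: fg[symmetric] left)
  moreover have "g (1, 0) - 2 * pi * \<i> * w 0 = g (1, 1) - 2 * pi * \<i> * w 1"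
    by (rule exp_eq_1_endpoints[where h = "\<lambda>t. g (1, t) - 2 * pi * \<i> * w t"])
       (auto intro!: cont continuous_intros w simp: exp_diff fg[symmetric] right)
  ultimately show False using w by simp
qed

section \<open>Exit paths in the horn with loops\<close>

text \<open>An exit path that does not start at vertex \<open>0\<close> avoids all loops for a while. One that does is for a while
  in the union of the two faces opposite to \<open>2\<close> and \<open>3\<close>; these meet only in the \<open>p\<close>-stratum, so
  by connectedness the path is in only one of them, and the other one carries all loops of
  one parity. Afterwards the height is bounded away from \<open>0\<close>, where only finitely many loops are.\<close>
lemma link_path_avoids_loops:
  fixes c :: "real \<Rightarrow> ambient"
  assumes c: "continuous_map (top_of_set {0..1}) ambient_topology c" and cX: "\<And>t. t \<in> {0..1} \<Longrightarrow> c t \<in> looped_horn"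
    and h0: "height (c 0) = 0" and h1: "\<And>t. t \<in> {0<..1} \<Longrightarrow> height (c t) \<noteq> 0"
  obtains b N where "\<And>k t. \<lbrakk>even k = b; N \<le> k; t \<in> {0..1}\<rbrakk> \<Longrightarrow> snd (c t) k = 1"
proof -
  define a where "a i t = fst (c t) i" for i t
  have a: "continuous_on {0..1} (a i)" for i
    using continuous_map_compose[OF c continuous_map_coordinate] by (simp add: o_def a_def[abs_def])
  have simplex: "fst (c t) \<in> standard_simplex 3" and hrn: "fst (c t) \<in> horn" if "t \<in> {0..1}" for t
    using cX[OF that] by (auto simp: looped_horn_def looped_simplex_def)
  have a0: "0 \<le> a i t" if "t \<in> {0..1}" for i t
    using simplex[OF that] by (simp add: a_def standard_simplex_def)
  have ht: "height (c t) = a 2 t + a 3 t" for t by (simp add: height_def a_def)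
  have win: "height (c t) \<in> window k" if "snd (c t) k \<noteq> 1" "t \<in> {0..1}" for t k
    using cX[OF that(2)] that(1) by (auto simp: looped_horn_def looped_simplex_def)
  have side: "a 1 t = 0" "a (if even k then 3 else 2) t = 0" if "snd (c t) k \<noteq> 1" "t \<in> {0..1}" for t k
    using cX[OF that(2)] that(1) by (auto simp: looped_horn_def a_def split: if_splits)
  have zero: "snd (c 0) k = 1" for k
  proof (rule ccontr)
    assume "snd (c 0) k \<noteq> 1"
    then have "height (c 0) \<in> window k" by (rule win) simp
    then have "0 \<in> window k" by (simp add: h0)
    moreover have "0 < 3 / (3 * real k + 7)" by simp
    ultimately show False by (simp add: window_def)
  qed
  have near0: "\<exists>d>0. d \<le> 1 \<and> (\<forall>t\<in>{0..d}. 0 < a i t)" if pos: "0 < a i 0" for i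
  proof -
    obtain r where r: "r > 0" "\<And>t. \<lbrakk>t \<in> {0..1}; dist t 0 < r\<rbrakk> \<Longrightarrow> dist (a i t) (a i 0) < a i 0"
      using a[of i] pos unfolding continuous_on_iff by (metis atLeastAtMost_iff order_refl zero_le_one)
    have "0 < a i t" if "t \<in> {0..min 1 (r/2)}" for t
      using r(2)[of t] that r(1) by (auto simp: dist_real_def)
    then show ?thesis using r(1) by (intro exI[of _ "min 1 (r/2)"]) auto
  qed
  have "\<exists>d b. 0 < d \<and> d \<le> 1 \<and> (\<forall>k. \<forall>t\<in>{0..d}. even k = b \<longrightarrow> snd (c t) k = 1)"
  proof (cases "a 1 0 = 0")
    case False
    then have "0 < a 1 0" using a0[of 0 1] by simp
    then obtain d where d: "d > 0" "d \<le> 1" "\<And>t. t \<in> {0..d} \<Longrightarrow> 0 < a 1 t"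
      using near0[of 1] by auto
    have "snd (c t) k = 1" if "t \<in> {0..d}" for k t
      using side(1)[of t k] d(2) d(3)[OF that] that by force
    then show ?thesis using d(1,2) by (intro exI[of _ d] exI[of _ True]) blast
  next
    case True
    have "{..3} = {0, 1, 2, 3 :: nat}" by auto
    then have "a 0 0 + a 1 0 + a 2 0 + a 3 0 = 1"
      using simplex[of 0] by (simp add: standard_simplex_def a_def)
    then have "0 < a 0 0" using True h0 by (simp add: ht)
    then obtain d where d: "d > 0" "d \<le> 1" "\<And>t. t \<in> {0..d} \<Longrightarrow> 0 < a 0 t"
      using near0[of 0] by auto
    have face: "a 2 t = 0 \<or> a 3 t = 0" if "t \<in> {0..d}" for t
      using hrn[of t] d(2) d(3)[OF that] that by (auto simp: horn_def a_def)
    have nz: "a 2 t - a 3 t \<noteq> 0" if "t \<in> {0<..d}" for t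
      using face[of t] h1[of t] that d(2) by (auto simp: ht)
    have contd: "continuous_on {0<..d} (\<lambda>t. a 2 t - a 3 t)"
      using d(2) by (intro continuous_on_diff continuous_on_subset[OF a]) auto
    have conn: "connected ((\<lambda>t. a 2 t - a 3 t) ` {0<..d})"
      by (rule connected_continuous_image[OF contd]) simp
    have "(\<forall>t\<in>{0<..d}. 0 < a 2 t - a 3 t) \<or> (\<forall>t\<in>{0<..d}. a 2 t - a 3 t < 0)"
    proof (rule ccontr)
      assume "\<not> ?thesis"
      then obtain t s where "t \<in> {0<..d}" "s \<in> {0<..d}" "a 2 t - a 3 t \<le> 0" "0 \<le> a 2 s - a 3 s"
        by (auto simp: not_less)
      then have "0 \<in> (\<lambda>t. a 2 t - a 3 t) ` {0<..d}"
        using connectedD_interval[OF conn] by blast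
      then show False using nz by force
    qed
    then have "\<exists>b. \<forall>t\<in>{0<..d}. 0 < a (if b then 3 else 2) t"
    proof
      assume p: "\<forall>t\<in>{0<..d}. 0 < a 2 t - a 3 t"
      have "0 < a 2 t" if "t \<in> {0<..d}" for t
        using p that a0[of t 3] d(2) by force
      then show ?thesis by (intro exI[of _ False]) simp
    next
      assume p: "\<forall>t\<in>{0<..d}. a 2 t - a 3 t < 0"
      have "0 < a 3 t" if "t \<in> {0<..d}" for t
        using p that a0[of t 2] d(2) by force
      then show ?thesis by (intro exI[of _ True]) simp
    qed
    then obtain b where b: "\<And>t. t \<in> {0<..d} \<Longrightarrow> 0 < a (if b then 3 else 2) t" by blast
    have "snd (c t) k = 1" if "t \<in> {0..d}" "even k = b" for k t
    proof (cases "t = 0")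
      case False
      then show ?thesis using side(2)[of t k] b[of t] that d(2) by force
    qed (simp add: zero)
    then show ?thesis using d(1,2) by blast
  qed
  then obtain d b where d: "0 < d" "d \<le> 1"
    and start: "\<And>k t. \<lbrakk>t \<in> {0..d}; even k = b\<rbrakk> \<Longrightarrow> snd (c t) k = 1" by blast
  have "continuous_on {d..1} (\<lambda>t. height (c t))"
    unfolding ht using d by (intro continuous_on_add continuous_on_subset[OF a]) auto
  then obtain m where m: "m \<in> {d..1}" "\<And>t. t \<in> {d..1} \<Longrightarrow> height (c m) \<le> height (c t)"
    using continuous_attains_inf[of "{d..1}" "\<lambda>t. height (c t)"] d by auto
  define \<epsilon> where "\<epsilon> = height (c m)"
  have "0 \<le> \<epsilon>" using a0[of m 2] a0[of m 3] m(1) d by (simp add: \<epsilon>_def ht)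
  then have \<epsilon>: "0 < \<epsilon>" using h1[of m] m(1) d by (simp add: \<epsilon>_def less_le)
  obtain N :: nat where N: "3 / \<epsilon> < real N" using reals_Archimedean2 by blast
  have "snd (c t) k = 1" if "even k = b" "N \<le> k" "t \<in> {0..1}" for k t
  proof (cases "t \<le> d")
    case True
    then show ?thesis using start that by auto
  next
    case False
    show ?thesis
    proof (rule ccontr)
      assume "snd (c t) k \<noteq> 1"
      then have "height (c t) < 3 / (3 * real k + 5)" using win that by (auto simp: window_def)
      moreover have "\<epsilon> \<le> height (c t)" using m(2)[of t] False that by (simp add: \<epsilon>_def)
      moreover have "3 / \<epsilon> < 3 * real k + 5" using N that(2) by simp
      then have "3 / (3 * real k + 5) < \<epsilon>" using \<epsilon> by (simp add: field_simps)
      ultimately show False by simp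
    qed
  qed
  then show thesis by (rule that)
qed


section \<open>The spiral\<close>

text \<open>How far the \<open>k\<close>-th loop has been traversed at height \<open>t\<close>, as a fraction of a full turn.\<close>
definition turn :: "nat \<Rightarrow> real \<Rightarrow> real" where
  "turn k t = max 0 (min 1
     ((t - 3 / (3 * real k + 7)) / (3 / (3 * real k + 5) - 3 / (3 * real k + 7))))"

definition loop :: "nat \<Rightarrow> real \<Rightarrow> complex" where
  "loop k t = exp (2 * pi * \<i> * turn k t)"

text \<open>Its sign decides about the side of the spiral at height \<open>t\<close>; the factor \<open>t\<close> makes it continuous at \<open>0\<close>.\<close>
definition wave :: "real \<Rightarrow> real" where
  "wave t = t * cos (pi / t)"

text \<open>The path down the edge from \<open>0\<close> to \<open>2\<close> (or to \<open>3\<close>) that traverses all loops attached to this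
  edge. It is a path on the whole interval, not just on the part where the spiral uses it:
  only then continuity into a Delta-generated refinement is automatic.\<close>
definition descent :: "bool \<Rightarrow> real \<Rightarrow> ambient" where
  "descent b t = ((\<lambda>i. if i = 0 then 1 - t else if i = (if b then 2 else 3) then t else 0),
     (\<lambda>k. if even k = b then loop k t else 1))"

text \<open>The path in the face opposite to vertex \<open>1\<close> that oscillates between the two edges without traversing
  any loop. It is on the edge to \<open>2\<close> if \<open>wave t \<ge> t / 2\<close> and on the edge to \<open>3\<close> if \<open>wave t \<le> - t / 2\<close>.\<close>
definition zigzag :: "real \<Rightarrow> ambient" where
  "zigzag t = (let y = max 0 (min t (t / 2 - wave t)) in
     ((\<lambda>i. if i = 0 then 1 - t else if i = 2 then t - y else if i = 3 then y else 0), \<lambda>_. 1))"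

lemma window_ends: "3 / (3 * real k + 7) < 3 / (3 * real k + 5)"
  by (simp add: field_simps)

lemma continuous_turn: "continuous_on S (turn k)"
  unfolding turn_def[abs_def] using window_ends[of k]
  by (intro continuous_intros) auto

lemma turn_high:
  assumes "3 / (3 * real k + 5) \<le> t"
  shows "turn k t = 1"
proof -
  have "1 \<le> (t - 3 / (3 * real k + 7)) / (3 / (3 * real k + 5) - 3 / (3 * real k + 7))"
    using window_ends[of k] assms by (subst le_divide_eq_1_pos) auto
  then show ?thesis by (simp add: turn_def)
qed

lemma turn_low:
  assumes "t \<le> 3 / (3 * real k + 7)"
  shows "turn k t = 0"
proof -
  have "(t - 3 / (3 * real k + 7)) / (3 / (3 * real k + 5) - 3 / (3 * real k + 7)) \<le> 0"
    using window_ends[of k] assms by (intro divide_nonpos_pos) auto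
  then show ?thesis by (simp add: turn_def)
qed

lemma turn_0: "turn k 0 = 0"
  by (rule turn_low) simp

lemma turn_1: "turn k 1 = 1"
  by (rule turn_high) (simp add: field_simps)

lemma loop_outside: "t \<notin> window k \<Longrightarrow> loop k t = 1"
  using turn_high[of k t] turn_low[of t k]
  by (force simp: loop_def window_def not_less exp_eq_1)

lemma norm_loop: "norm (loop k t) = 1"
  by (simp add: loop_def norm_exp_eq_Re)

lemma continuous_loop: "continuous_on S (loop k)"
  unfolding loop_def[abs_def] by (intro continuous_intros continuous_turn)

lemma continuous_wave: "continuous_on {0..1} wave"
proof -
  have "continuous_on {0..1} (\<lambda>t::real. t * cos (pi / t))"
    unfolding continuous_on_eq_continuous_within
  proof
    fix x :: real assume "x \<in> {0..1}"
    show "continuous (at x within {0..1}) (\<lambda>t. t * cos (pi / t))"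
    proof (cases "x = 0")
      case True
      have "((\<lambda>t::real. t * cos (pi / t)) \<longlongrightarrow> 0) (at 0 within {0..1})"
      proof (rule Lim_null_comparison)
        show "\<forall>\<^sub>F t in at 0 within {0..1}. norm (t * cos (pi / t)) \<le> \<bar>t\<bar>"
          by (intro always_eventually allI) (simp add: abs_mult mult_left_le)
        show "((\<lambda>t::real. \<bar>t\<bar>) \<longlongrightarrow> 0) (at 0 within {0..1})"
          by (rule tendsto_eq_intros | simp)+
      qed
      then show ?thesis by (simp add: True continuous_within)
    next
      case False
      then show ?thesis by (intro continuous_intros) auto
    qed
  qed
  then show ?thesis by (simp add: wave_def[abs_def])
qed

lemma wave_window:
  assumes t: "t \<in> window k"
  shows "0 < t" "even k \<Longrightarrow> t / 2 < wave t" "odd k \<Longrightarrow> wave t < - t / 2"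
proof -
  have "0 < 3 / (3 * real k + 7)" by simp
  also have "\<dots> < t" using t by (simp add: window_def)
  finally show pos: "0 < t" .
  have "3 < t * (3 * real k + 7)" "t * (3 * real k + 5) < 3"
    using t by (auto simp: window_def divide_less_eq less_divide_eq)
  then have bd: "1 / t < real k + 7 / 3" "real k + 5 / 3 < 1 / t"
    using pos by (simp_all add: field_simps)
  define d where "d = 1 / t - (real k + 2)"
  then have "1 / t = d + real k + 2" by simp
  with bd have "\<bar>d\<bar> < 1 / 3" unfolding abs_less_iff by simp
  then have "cos (pi / 3) < cos \<bar>pi * d\<bar>"
    by (intro cos_monotone_0_pi) (auto simp: abs_mult)
  then have half: "1 / 2 < cos (pi * d)" by (simp add: cos_60)
  have "pi / t = pi * d + real (k + 2) * pi"
    by (simp add: d_def algebra_simps)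
  then have "cos (pi / t) = cos (pi * d) * cos (real (k + 2) * pi)"
    by (simp only: cos_add sin_npi mult_zero_right diff_zero)
  then have cos: "cos (pi / t) = (- 1) ^ k * cos (pi * d)"
    by (simp only: cos_npi, simp)
  show "t / 2 < wave t" if "even k"
    using that half pos by (simp add: wave_def cos)
  show "wave t < - t / 2" if "odd k"
    using that half pos by (simp add: wave_def cos)
qed

lemma height_descent: "height (descent b t) = t"
  by (simp add: height_def descent_def)

lemma height_zigzag: "height (zigzag t) = t"
  by (simp add: height_def zigzag_def Let_def)

lemma sum_4: "sum f {..3 :: nat} = f 0 + f 1 + f 2 + (f 3 :: real)"
proof -
  have "{..3} = {0, 1, 2, 3 :: nat}" by auto
  then show ?thesis by simp
qed

lemma descent_in_looped_horn: "t \<in> {0..1} \<Longrightarrow> descent b t \<in> looped_horn"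
  using loop_outside
  by (auto simp: looped_horn_def looped_simplex_def horn_def standard_simplex_def descent_def sum_4 norm_loop height_def)

lemma zigzag_flat: "t \<in> {0..1} \<Longrightarrow> zigzag t \<in> flat (standard_simplex 3)"
  by (auto simp: zigzag_def Let_def flat_def standard_simplex_def sum_4)

lemma descent_0: "descent b 0 = descent b' 0"
  by (auto simp: descent_def loop_def turn_0 fun_eq_iff)

lemma zigzag_eq_descent_True:
  assumes "t \<in> {0..1}" "wave t = t / 2"
  shows "zigzag t = descent True t"
proof -
  have "loop k t = 1" if "even k" for k
    using wave_window(2)[of t k] that assms by (intro loop_outside) auto
  then show ?thesis using assms by (auto simp: zigzag_def descent_def fun_eq_iff)
qed

lemma zigzag_eq_descent_False:
  assumes "t \<in> {0..1}" "wave t = - t / 2"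
  shows "zigzag t = descent False t"
proof -
  have "loop k t = 1" if "odd k" for k
    using wave_window(3)[of t k] that assms by (intro loop_outside) auto
  then show ?thesis using assms by (auto simp: zigzag_def descent_def fun_eq_iff)
qed

lemma continuous_map_descent: "continuous_map (top_of_set {0..1}) ambient_topology (descent b)"
proof (rule continuous_map_into_ambient_topology)
  fix i show "continuous_map (top_of_set {0..1}) euclideanreal (\<lambda>t. fst (descent b t) i)"
    by (cases "i = 0"; cases "i = (if b then 2 else 3)") (simp_all add: descent_def continuous_intros)
next
  fix k show "continuous_map (top_of_set {0..1}) euclidean (\<lambda>t. snd (descent b t) k)"
    by (cases "even k = b") (simp_all add: descent_def continuous_loop)
qed

lemma continuous_map_zigzag: "continuous_map (top_of_set {0..1}) ambient_topology zigzag"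
proof (rule continuous_map_into_ambient_topology)
  fix i
  have "continuous_on {0..1} (\<lambda>t. max 0 (min t (t / 2 - wave t)))"
    by (intro continuous_intros continuous_wave) auto
  then show "continuous_map (top_of_set {0..1}) euclideanreal (\<lambda>t. fst (zigzag t) i)"
    by (cases "i = 0"; cases "i = 2"; cases "i = 3") (simp_all add: zigzag_def Let_def continuous_intros)
qed (simp add: zigzag_def Let_def)

text \<open>The image in \<open>W\<close> of the path in \<open>Z\<close> that follows \<open>descent\<close> through \<open>X\<close> while it is on one of the two edges,
  and crosses through the tetrahedron in between.\<close>
definition spiral :: "real \<Rightarrow> ambient" where
  "spiral t = (if t / 2 \<le> wave t then descent True t
     else if wave t \<le> - t / 2 then descent False t else zigzag t)"

text \<open>Each loop is traversed in full, as its window is in the range where the spiral runs on the edge of the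
  right side.\<close>
lemma snd_spiral:
  assumes "t \<in> {0..1}"
  shows "snd (spiral t) k = loop k t"
proof (cases "t \<in> window k")
  case True
  then show ?thesis using wave_window[OF True] by (cases "even k") (auto simp: spiral_def descent_def)
next
  case False
  then show ?thesis by (simp add: spiral_def descent_def zigzag_def Let_def loop_outside)
qed

section \<open>The contradiction\<close>

lemma topspace_holink:
  "topspace (holink p q Y) = holink_set p q Y"
  by (auto simp: holink_def topspace_compact_open holink_set_def)

lemma holink_homotopy:
  fixes Y :: "('a, 'p) strat_space"
  assumes "path_component_of (holink p q Y) \<gamma> \<gamma>'"
  obtains P :: "real \<Rightarrow> real \<Rightarrow> 'a" where "continuous_map (prod_topology (top_of_set {0..1}) (top_of_set {0..1})) (fst Y)
      (\<lambda>y. P (fst y) (snd y))"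
    and "\<And>u. u \<in> {0..1} \<Longrightarrow> P u \<in> holink_set p q Y" and "P 0 = \<gamma>" and "P 1 = \<gamma>'"
proof -
  obtain P where "pathin (holink p q Y) P \<and> P 0 = \<gamma> \<and> P 1 = \<gamma>'"
    using assms unfolding path_component_of_def by (elim exE)
  then have P: "continuous_map (top_of_set {0..1}) (holink p q Y) P" "P 0 = \<gamma>" "P 1 = \<gamma>'"
    by (simp_all add: pathin_def)
  have 1: "P u \<in> holink_set p q Y" if "u \<in> {0..1}" for u
    using continuous_map_funspace[OF P(1)] that by (auto simp: topspace_holink)
  have "continuous_map (top_of_set {0..1}) (compact_open (top_of_set {0..1}) (fst Y)) P"
    using continuous_map_into_delta_ificationD[OF P(1)[unfolded holink_def]]
    by (rule continuous_map_into_fulltopology)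
  from that[OF continuous_map_uncurry[OF this] 1 P(2,3)] show thesis .
qed

context encoding begin

lemma no_model_structure:
  fixes Weq Cof Fib :: "(('u, 'p) strat_space, 'u \<Rightarrow> 'u) arrow set"
  assumes model: "model_structure Top_P Weq Cof Fib"
    and mono: "\<And>i f. \<lbrakk>monomorphism sSet_P i; f \<in> Arr Top_P; is_realization_of f i\<rbrakk> \<Longrightarrow> f \<in> Cof"
    and hequiv: "\<And>f. \<lbrakk>f \<in> Arr Top_P; strat_homotopy_equivalence (src f) (tgt f) (fn f)\<rbrakk> \<Longrightarrow> f \<in> Weq"
    and links: "\<And>f. f \<in> Weq \<Longrightarrow>
      weak_homotopy_equivalence (holink p q (src f)) (holink p q (tgt f)) (holink_map (fn f))"
  shows False
proof -
  interpret model_structure Top_P Weq Cof Fib by (rule model)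
  let ?A = "flat horn" and ?B = "flat (standard_simplex 3)"
  have AB: "?A \<subseteq> ?B" using horn_subset by (auto simp: flat_def)
  have AX: "?A \<subseteq> looped_horn" by (rule flat_horn_subset)
  have BW: "?B \<subseteq> looped_simplex" by (rule flat_subset_looped_simplex) simp
  have i: "incl ?A ?B \<in> Cof \<inter> Weq"
  proof -
    have "incl ?A ?B \<in> Arr Top_P" using incl_hom[OF AB] by (simp add: cat_hom_def)
    then show ?thesis
      using mono[OF monomorphism_horn_incl _ is_realization_of_horn_incl]
        hequiv strat_homotopy_equivalence_horn by (simp add: incl_def)
  qed
  obtain Z J R where J: "J \<in> cat_hom Top_P (space_of looped_horn) Z" "J \<in> Cof \<inter> Weq"
    and R: "R \<in> cat_hom Top_P Z (space_of looped_simplex)" "R \<in> Fib"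
    and RJ: "Comp Top_P R J = incl looped_horn looped_simplex"
    using factorization(1)[OF incl_hom[OF looped_horn_subset]] by blast
  obtain j where j: "J = Arrow (space_of looped_horn) Z j" "strat_map (space_of looped_horn) Z j"
    using J(1) by (auto simp: cat_hom_Top_P)
  obtain r where r: "R = Arrow Z (space_of looped_simplex) r" "strat_map Z (space_of looped_simplex) r"
    using R(1) by (auto simp: cat_hom_Top_P)
  have rj: "r (j (e x)) = e x" if "x \<in> looped_horn" for x
    using fun_cong[OF arg_cong[OF RJ, of fn], of "e x"] that
    by (simp add: Top_P_def j(1) r(1) incl_def compose_def)
  have "has_lifting Top_P (incl ?A ?B) R" using lifting(1)[OF i R(2)] .
  moreover have "Comp Top_P J (incl ?A looped_horn) \<in> cat_hom Top_P (Dom Top_P (incl ?A ?B)) (Dom Top_P R)"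
    using comp[OF incl_hom[OF AX] J(1)] by (simp add: Top_P_def incl_def r(1))
  moreover have "incl ?B looped_simplex \<in> cat_hom Top_P (Cod Top_P (incl ?A ?B)) (Cod Top_P R)"
    using incl_hom[OF BW] by (simp add: Top_P_def incl_def r(1))
  moreover have "Comp Top_P R (Comp Top_P J (incl ?A looped_horn)) = Comp Top_P (incl ?B looped_simplex) (incl ?A ?B)"
  proof -
    have "compose (e ` ?A) r (compose (e ` ?A) j (restrict id (e ` ?A))) =
        compose (e ` ?A) (restrict id (e ` ?B)) (restrict id (e ` ?A))"
      using rj subsetD[OF AX] subsetD[OF AB] by (auto simp: fun_eq_iff compose_def)
    then show ?thesis by (simp add: Top_P_def incl_def j(1) r(1))
  qed
  ultimately obtain L where L: "L \<in> cat_hom Top_P (Cod Top_P (incl ?A ?B)) (Dom Top_P R)"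
    and LA: "Comp Top_P L (incl ?A ?B) = Comp Top_P J (incl ?A looped_horn)"
    and RL: "Comp Top_P R L = incl ?B looped_simplex"
    unfolding has_lifting_def by blast
  have "L \<in> cat_hom Top_P (space_of ?B) Z"
    using L by (simp add: Top_P_def incl_def r(1))
  then obtain l where l: "L = Arrow (space_of ?B) Z l" "strat_map (space_of ?B) Z l"
    by (auto simp: cat_hom_Top_P)
  have lj: "l (e x) = j (e x)" if "x \<in> ?A" for x
    using fun_cong[OF arg_cong[OF LA, of fn], of "e x"] that subsetD[OF AB that] subsetD[OF AX that]
    by (simp add: Top_P_def j(1) l(1) incl_def compose_def)
  have rl: "r (l (e x)) = e x" if "x \<in> ?B" for x
    using fun_cong[OF arg_cong[OF RL, of fn], of "e x"] that
    by (simp add: Top_P_def l(1) r(1) incl_def compose_def)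

  \<comment> \<open>The spiral, lifted to \<open>Z\<close>: \<open>j\<close> is the map from \<open>X\<close>, \<open>l\<close> the map from the tetrahedron.\<close>
  define \<Gamma> where "\<Gamma> t = (if t / 2 \<le> wave t then j (e (descent True t))
     else if wave t \<le> - t / 2 then j (e (descent False t)) else l (e (zigzag t)))" for t
  have r\<Gamma>: "r (\<Gamma> t) = e (spiral t)" if "t \<in> {0..1}" for t
    using rj[OF descent_in_looped_horn[OF that]] rl[OF zigzag_flat[OF that]] by (simp add: \<Gamma>_def spiral_def)
  have down: "continuous_map (top_of_set {0..1}) (fst Z) (\<lambda>t. j (e (descent b t)))" for b
  proof -
    have "continuous_map (top_of_set {0..1}) (fst (space_of looped_horn)) (e \<circ> descent b)"
      by (rule continuous_map_into_space_of[OF delta_generated_unit_interval continuous_map_descent])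
         (simp add: descent_in_looped_horn)
    from continuous_map_compose[OF this] show ?thesis
      using j(2) by (auto simp: strat_map_def o_def)
  qed
  have cross: "continuous_map (top_of_set {0..1}) (fst Z) (\<lambda>t. l (e (zigzag t)))"
  proof -
    have "continuous_map (top_of_set {0..1}) (fst (space_of ?B)) (e \<circ> zigzag)"
      by (rule continuous_map_into_space_of[OF delta_generated_unit_interval continuous_map_zigzag])
         (simp add: zigzag_flat)
    from continuous_map_compose[OF this] show ?thesis
      using l(2) by (auto simp: strat_map_def o_def)
  qed
  have meet: "l (e (zigzag t)) = j (e (descent b t))"
    if "t \<in> {0..1}" "zigzag t = descent b t" for t b
  proof -
    have "zigzag t \<in> ?A"
      using zigzag_flat[OF that(1)] descent_in_looped_horn[OF that(1), of b] that(2)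
      by (auto simp: flat_def looped_horn_def)
    then show ?thesis using lj that(2) by simp
  qed
  have wv: "continuous_map (top_of_set {0..1}) euclideanreal wave"
    by (simp add: continuous_wave)
  have half: "continuous_map (top_of_set {0..1}) euclideanreal (\<lambda>t. t / 2)"
    and minus_half: "continuous_map (top_of_set {0..1}) euclideanreal (\<lambda>t. - t / 2)"
    by (simp_all add: continuous_intros)
  have inner: "continuous_map (top_of_set {0..1}) (fst Z)
      (\<lambda>t. if wave t \<le> - t / 2 then j (e (descent False t)) else l (e (zigzag t)))"
    by (rule continuous_map_cases_le[OF wv minus_half
          continuous_map_from_subtopology[OF down] continuous_map_from_subtopology[OF cross]])
       (use meet zigzag_eq_descent_False in auto)
  have "continuous_map (top_of_set {0..1}) (fst Z) \<Gamma>"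
    unfolding \<Gamma>_def
  proof (rule continuous_map_cases_le[OF half wv
        continuous_map_from_subtopology[OF down] continuous_map_from_subtopology[OF inner]])
    fix t :: real assume t: "t \<in> topspace (top_of_set {0..1})" and eq: "t / 2 = wave t"
    show "j (e (descent True t)) =
        (if wave t \<le> - t / 2 then j (e (descent False t)) else l (e (zigzag t)))"
    proof (cases "wave t \<le> - t / 2")
      case True
      then have "t = 0" using eq t by simp
      then show ?thesis using descent_0[of True False] True by simp
    next
      case False
      then show ?thesis using meet[OF _ zigzag_eq_descent_True] eq t by simp
    qed
  qed
  then have contG: "continuous_map (top_of_set {0..1}) (fst Z) (restrict \<Gamma> {0..1})"
    by (rule continuous_map_eq) simp
  have strG: "\<Gamma> t \<in> topspace (fst Z) \<and> snd Z (\<Gamma> t) = (if t = 0 then p else q)"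
    if t: "t \<in> {0..1}" for t
  proof -
    have "j (e x) \<in> topspace (fst Z) \<and> snd Z (j (e x)) = level x" if "x \<in> looped_horn" for x
      using j(2) that continuous_map_funspace[of "fst (space_of looped_horn)" "fst Z" j]
      by (auto simp: strat_map_def snd_space_of Pi_iff)
    moreover have "l (e x) \<in> topspace (fst Z) \<and> snd Z (l (e x)) = level x" if "x \<in> ?B" for x
      using l(2) that continuous_map_funspace[of "fst (space_of ?B)" "fst Z" l]
      by (auto simp: strat_map_def snd_space_of Pi_iff)
    ultimately have
      "j (e (descent b t)) \<in> topspace (fst Z) \<and> snd Z (j (e (descent b t))) = (if t = 0 then p else q)"
      "l (e (zigzag t)) \<in> topspace (fst Z) \<and> snd Z (l (e (zigzag t))) = (if t = 0 then p else q)" for b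
      using descent_in_looped_horn[OF t] zigzag_flat[OF t]
      by (simp_all add: level_def height_descent height_zigzag)
    then show ?thesis unfolding \<Gamma>_def by presburger
  qed
  have G: "restrict \<Gamma> {0..1} \<in> holink_set p q Z"
    using contG strG by (auto simp: holink_set_def stratum_def)

  have "weak_homotopy_equivalence (holink p q (space_of looped_horn)) (holink p q Z) (holink_map j)"
    using links[of J] J(2) by (simp add: j(1))
  then have bij: "bij_betw (\<lambda>c. \<Union>x\<in>c. path_component_of_set (holink p q Z) (holink_map j x))
       (path_components_of (holink p q (space_of looped_horn))) (path_components_of (holink p q Z))"
    by (simp add: weak_homotopy_equivalence_def)
  have "path_component_of_set (holink p q Z) (restrict \<Gamma> {0..1}) \<in> path_components_of (holink p q Z)"
    using G by (auto simp: path_components_of_def topspace_holink)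
  then obtain c where c: "c \<in> path_components_of (holink p q (space_of looped_horn))"
    and "(\<Union>x\<in>c. path_component_of_set (holink p q Z) (holink_map j x)) =
      path_component_of_set (holink p q Z) (restrict \<Gamma> {0..1})"
    using bij unfolding bij_betw_def by (metis (mono_tags, lifting) imageE)
  moreover have "restrict \<Gamma> {0..1} \<in> path_component_of_set (holink p q Z) (restrict \<Gamma> {0..1})"
    using G by (simp add: path_component_of_refl topspace_holink)
  ultimately obtain \<gamma> where \<gamma>c: "\<gamma> \<in> c"
    and pc: "path_component_of (holink p q Z) (holink_map j \<gamma>) (restrict \<Gamma> {0..1})"
    by blast
  have "c \<subseteq> topspace (holink p q (space_of looped_horn))"
    using path_components_of_subset[OF c] .
  then have \<gamma>: "\<gamma> \<in> holink_set p q (space_of looped_horn)" using \<gamma>c by (auto simp: topspace_holink)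

  obtain P :: "real \<Rightarrow> real \<Rightarrow> 'u" where P: "continuous_map (prod_topology (top_of_set {0..1}) (top_of_set {0..1})) (fst Z)
      (\<lambda>y. P (fst y) (snd y))"
    and Plink: "\<And>u. u \<in> {0..1} \<Longrightarrow> P u \<in> holink_set p q Z"
    and P0: "P 0 = holink_map j \<gamma>" and P1: "P 1 = restrict \<Gamma> {0..1}"
  proof (rule holink_homotopy[OF pc])
    fix P :: "real \<Rightarrow> real \<Rightarrow> 'u"
    assume "continuous_map (prod_topology (top_of_set {0..1}) (top_of_set {0..1})) (fst Z)
        (\<lambda>y. P (fst y) (snd y))" "\<And>u. u \<in> {0..1} \<Longrightarrow> P u \<in> holink_set p q Z"
      "P 0 = holink_map j \<gamma>" "P 1 = restrict \<Gamma> {0..1}"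
    then show thesis by (rule that[of P])
  qed
  \<comment> \<open>The homotopy, projected from \<open>Z\<close> to \<open>W\<close> and read in the ambient space.\<close>
  define D where "D y = inv_into UNIV e (r (P (fst y) (snd y)))" for y :: "real \<times> real"
  let ?II = "prod_topology (top_of_set {0..1::real}) (top_of_set {0..1::real})"
  have "continuous_map ?II (fst (space_of looped_simplex)) (\<lambda>y. r (P (fst y) (snd y)))"
    using continuous_map_compose[OF P] r(2) by (auto simp: strat_map_def o_def)
  from continuous_map_compose[OF this continuous_map_decode]
  have DW: "continuous_map ?II (subtopology ambient_topology looped_simplex) D"
    by (simp add: D_def[abs_def] o_def)
  have D: "continuous_map ?II ambient_topology D" by (rule continuous_map_into_fulltopology[OF DW])
  have II: "?II = top_of_set ({0..1} \<times> {0..1})"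
    by (simp add: subtopology_Times[symmetric])
  have inW: "D y \<in> looped_simplex" if "y \<in> {0..1} \<times> {0..1}" for y
    using continuous_map_funspace[OF DW] that by auto
  have hgt: "height (D (u, t)) = 0 \<longleftrightarrow> t = 0" if "u \<in> {0..1}" "t \<in> {0..1}" for u t
  proof -
    have "P u t \<in> stratum Z (if t = 0 then p else q)"
      using Plink[OF that(1)] that(2) by (auto simp: holink_set_def)
    then have "P u t \<in> topspace (fst Z)" "snd Z (P u t) = (if t = 0 then p else q)"
      by (auto simp: stratum_def)
    then have "r (P u t) \<in> e ` looped_simplex" "snd (space_of looped_simplex) (r (P u t)) = (if t = 0 then p else q)"
      using r(2) continuous_map_funspace[of "fst Z" "fst (space_of looped_simplex)" r]
      by (auto simp: strat_map_def Pi_iff)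
    then have "level (D (u, t)) = (if t = 0 then p else q)"
      by (auto simp: D_def inj_e snd_space_of)
    then show ?thesis using less by (auto simp: level_def split: if_splits)
  qed
  have D0: "D (0, t) = inv_into UNIV e (\<gamma> t)" "\<gamma> t \<in> e ` looped_horn" if t: "t \<in> {0..1}" for t
  proof -
    show \<gamma>t: "\<gamma> t \<in> e ` looped_horn"
      using \<gamma> continuous_map_funspace[of _ "fst (space_of looped_horn)" \<gamma>] t
      by (fastforce simp: holink_set_def Pi_iff)
    then show "D (0, t) = inv_into UNIV e (\<gamma> t)"
      using t rj by (auto simp: D_def P0 holink_map_def compose_def)
  qed
  have D1: "D (1, t) = spiral t" if "t \<in> {0..1}" for t
    using that r\<Gamma> by (simp add: D_def P1 inj_e)

  have "continuous_map (top_of_set {0..1}) ambient_topology (\<lambda>t. D (0, t))"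
    using continuous_map_compose[OF continuous_map_pairedI[of "top_of_set {0..1::real}"
          "top_of_set {0..1::real}" "\<lambda>_. 0" "top_of_set {0..1::real}" id] D]
    by (simp add: o_def)
  then obtain b N where avoid: "\<And>k t. \<lbrakk>even k = b; N \<le> k; t \<in> {0..1}\<rbrakk> \<Longrightarrow> snd (D (0, t)) k = 1"
  proof (rule link_path_avoids_loops)
    show "D (0, t) \<in> looped_horn" if "t \<in> {0..1}" for t
      using D0[OF that] by (auto simp: inj_e)
  qed (use hgt[of 0] in auto)

  have "continuous_on ({0..1} \<times> {0..1}) (\<lambda>y. height (D y))"
    using continuous_map_compose[OF D continuous_map_height] by (simp add: II o_def)
  then have "continuous_on {0..1} (\<lambda>u. height (D (u, 1)))"
    by (rule continuous_on_compose2) (auto intro!: continuous_intros)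
  then obtain m where m: "m \<in> {0..1}" "\<And>u. u \<in> {0..1} \<Longrightarrow> height (D (m, 1)) \<le> height (D (u, 1))"
    using continuous_attains_inf[of "{0..1}" "\<lambda>u. height (D (u, 1))"] by auto
  have pos: "0 < height (D (m, 1))"
    using hgt[OF m(1), of 1] height_nonneg[OF inW, of "(m, 1)"] m(1) by simp
  obtain M :: nat where M: "3 / height (D (m, 1)) < real M" using reals_Archimedean2 by blast
  \<comment> \<open>A loop of the parity that \<open>\<gamma>\<close> avoids, below the heights of all end points.\<close>
  define k where "k = 2 * (M + N) + (if b then 0 else 1)"
  have k: "even k = b" "N \<le> k" "M \<le> k" by (auto simp: k_def)
  have "3 / height (D (m, 1)) < 3 * real k + 5" using M k(3) by simp
  then have low: "3 / (3 * real k + 5) < height (D (m, 1))" using pos by (simp add: field_simps)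
  have far: "snd (D y) k = 1" if "y \<in> {0..1} \<times> {0..1}" "height (D y) \<notin> window k" for y
    using inW[OF that(1)] that(2) by (auto simp: looped_simplex_def case_prod_unfold)
  show False
  proof (rule no_unwinding)
    show "continuous_on ({0..1} \<times> {0..1}) (\<lambda>y. snd (D y) k)"
      using continuous_map_compose[OF D continuous_map_angle] by (simp add: II o_def)
    show "snd (D y) k \<noteq> 0" if "y \<in> {0..1} \<times> {0..1}" for y
    proof -
      have "norm (snd (D y) k) = 1" using inW[OF that] by (auto simp: looped_simplex_def case_prod_unfold)
      then show ?thesis by auto
    qed
    show "snd (D (u, 0)) k = 1" if "u \<in> {0..1}" for u
    proof (rule far)
      have "0 \<le> 3 / (3 * real k + 7)" by simp
      then show "height (D (u, 0)) \<notin> window k" using hgt[OF that, of 0] by (simp add: window_def)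
    qed (use that in auto)
    show "snd (D (u, 1)) k = 1" if "u \<in> {0..1}" for u
    proof (rule far)
      show "height (D (u, 1)) \<notin> window k" using low m(2)[OF that] by (simp add: window_def)
    qed (use that in auto)
    show "snd (D (0, t)) k = 1" if "t \<in> {0..1}" for t
      using avoid k that by blast
    show "snd (D (1, t)) k = exp (2 * pi * \<i> * turn k t)" if "t \<in> {0..1}" for t
      using D1[OF that] snd_spiral[OF that] by (simp add: loop_def)
  qed (rule continuous_turn turn_0 turn_1)+
qed

end

theorem propositionA1:
  assumes non_discrete: "\<exists>p q :: 'p::order. p < q"
    and universe: "(UNIV :: real set) \<prec> (UNIV :: 'u set)"
  shows "\<not> (\<exists>Weq Cof Fib :: (('u, 'p) strat_space, 'u \<Rightarrow> 'u) arrow set.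
      model_structure Top_P Weq Cof Fib \<and>
      (\<forall>i :: (('u, 'p) strat_sset, nat \<Rightarrow> 'u \<Rightarrow> 'u) arrow. monomorphism sSet_P i \<longrightarrow>
         (\<forall>f \<in> Arr Top_P. is_realization_of f i \<longrightarrow> f \<in> Cof)) \<and>
      (\<forall>f \<in> Arr Top_P. strat_homotopy_equivalence (src f) (tgt f) (fn f) \<longrightarrow> f \<in> Weq) \<and>
      (\<forall>f \<in> Weq. \<forall>p q. p < q \<longrightarrow>
         weak_homotopy_equivalence (holink p q (src f)) (holink p q (tgt f)) (holink_map (fn f))))"
proof -
  obtain p q :: 'p where pq: "p < q" using non_discrete by blast
  have less: "(UNIV :: ambient set) \<prec> (UNIV :: 'u set)"
    using lesspoll_trans1[OF ambient_lepoll_real universe] .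
  then obtain e :: "ambient \<Rightarrow> 'u" where e: "inj e"
    unfolding lesspoll_def lepoll_def by blast
  have "range e \<prec> (UNIV :: 'u set)"
    using lesspoll_trans1[OF image_lepoll less] .
  then interpret encoding e p q by unfold_locales (use e pq in auto)
  show ?thesis
    using no_model_structure pq by blast
qed

end
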